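(* Consider the stochastic differential delay equation $$dx(t)=f(x(t),x(t-\delta(t)),t)\,dt+g(x(t),x(t-\delta(t)),t)\,dB(t),\quad t\ge 0,\qquad x_0=\xi,$$ and its modified truncated Euler–Maruyama (MTEM) approximation $X_k^\Delta$, with the setting and notation of the context. Suppose $\delta$ is unbounded. Assume: (i) there is a constant $\eta<1$ with $\delta'(t)\le\eta$ for all $t\ge0$; (ii) (local Lipschitz) for each $t\ge0$ and each $R$ there is $L_{R,t}>0$ (increasing in $R$) such that $$|f(x,y,t)-f(x',y',t)|\vee|g(x,y,t)-g(x',y',t)|\le L_{R,t}(|x-x'|+|y-y'|)$$ for all $|x|\vee|x'|\vee|y|\vee|y'|\le R$; (iii) there are positive constants $K,\lambda_0,\lambda_1,\lambda_2$ such that for all $t\ge0$ and $x,y\in\mathbb{R}^n$ $$2\langle x,f(x,y,t)\rangle+|g(x,y,t)|^2\le\frac{K(1+t)^{-\lambda_0}-\lambda_1|x|^2+\lambda_2|y|^2}{1+t};$$ (iv) $\lambda_1-\lambda_2([(1-\eta)^{-1}]+1)>0$; (v) $\displaystyle\lim_{R\to\infty}\sup_{t\ge0}(1+t)L_{R,t}^2\,h^{-1}(R)=0$, where $h^{-1}$ is the inverse function of $h$. Then the MTEM approximation $X_k^\Delta$ is both almost surely and mean square polynomially stable. That is, for any $$\max\left\{0,\frac{\lambda_1-\lambda_2([(1-\eta)^{-1}]+1)-1}{[(1-\eta)^{-1}]+2}\right\}<\varepsilon<\frac{\lambda_1-\lambda_2([(1-\eta)^{-1}]+1)}{[(1-\eta)^{-1}]+2}$$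 there exist $\Delta^*>0$ and $\tilde C>0$ such that for any $\Delta\in(0,\Delta^*]$ and $C\in(0,\tilde C)$, $$\limsup_{k\to\infty}\frac{\log|X_k^\Delta|}{\log(1+k\Delta)}\le-\frac{C}{2}\ \text{ a.s.},\qquad\text{and}\qquad \limsup_{k\to\infty}\frac{\log\mathbb{E}(|X_k^\Delta|^2)}{\log(1+k\Delta)}\le-C,$$ where $\tilde C=\tilde C_0\wedge\lambda_0$ and $\tilde C_0=\lambda_1-\varepsilon-(\lambda_2+\varepsilon)([(1-\eta)^{-1}]+1)$ $(<1)$.
   Context: $(\Omega,\mathscr F,P)$ is a complete probability space with a filtration $\{\mathscr F_t\}_{t\ge0}$ satisfying the usual conditions, and $B(t)$ is a $d$-dimensional standard Brownian motion on it (with respect to this filtration). $\tau\ge0$ is a constant; $C([-\tau,0];\mathbb{R}^n)$ is the space of continuous functions with norm $\|\phi\|=\sup_{-\tau\le\theta\le0}|\phi(\theta)|$; $C^b_{\mathscr F_0}([-\tau,0];\mathbb{R}^n)$ is the family of bounded, $\mathscr F_0$-measurable, $C([-\tau,0];\mathbb{R}^n)$-valued random variables. The initial value is $x_0=\xi=\{\xi(\theta),\theta\in[-\tau,0]\}\in C^b_{\mathscr F_0}([-\tau,0];\mathbb{R}^n)$, with $\mathbb{E}\|\xi\|^2<\infty$. $\delta\in C^1(\mathbb{R}_+,\mathbb{R}_+)$ with $\delta(0)=\tau$. The functions $f:\mathbb{R}^n\times\mathbb{R}^n\times[0,\infty)\to\mathbb{R}^n$ and $g:\mathbb{R}^n\times\mathbb{R}^n\times[0,\infty)\to\mathbb{R}^{n}\otimes\mathbb{R}^{d}$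 ($n\times d$ matrices) are Borel measurable, with $f(0,0,t)\equiv0$ and $g(0,0,t)\equiv0$. $|A|=\sqrt{\mathrm{trace}(A^{T}A)}$ for a matrix $A$; $a\vee b=\max\{a,b\}$, $a\wedge b=\min\{a,b\}$; $[x]$ is the integer part of $x$; $\log0=-\infty$. Truncation: for some $\Delta_0>0$, $h:(0,\Delta_0]\to(0,\infty)$ is a strictly positive decreasing function with $\lim_{\Delta\to0}h(\Delta)=\infty$, having an inverse function $h^{-1}$ with $h^{-1}(R)$ defined for all large $R$. For $\Delta\in(0,\Delta_0]$ put $$f_\Delta(x,y,t)=\begin{cases} f(x,y,t), & |x|\vee|y|\le h(\Delta),\\[2pt] \dfrac{|x|\vee|y|}{h(\Delta)}\,f\!\left(\dfrac{h(\Delta)}{|x|\vee|y|}x,\dfrac{h(\Delta)}{|x|\vee|y|}y,t\right), & |x|\vee|y|>h(\Delta),\end{cases}$$ and define $g_\Delta$ from $g$ in the same way. MTEM method: step sizes $\Delta\in(0,1)$ (in the domain of $h$) are always such that $\tau=m\Delta$ for an integer $m$ (positive if $\tau>0$, and $m=0$ if $\tau=0$); quantification over $\Delta\in(0,\Delta^*]$ is over such step sizes. Set $X_k^\Delta=\xi(k\Delta)$ for $k=-m,\dots,0$, and for $k=0,1,2,\dots$ $$X_{k+1}^\Delta=X_k^\Delta+f_\Delta\!\left(X_k^\Delta,X^\Delta_{k-[\delta(k\Delta)/\Delta]},k\Delta\right)\Delta+g_\Delta\!\left(X_k^\Delta,X^\Delta_{k-[\delta(k\Delta)/\Delta]},k\Delta\right)\Delta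 B_k,$$ where $\Delta B_k=B((k+1)\Delta)-B(k\Delta)$. Polynomial stability of the approximation: $X_k^\Delta$ is mean square polynomially stable if there exist $\Delta^*>0$ and $\gamma>0$ such that for any $0<\Delta\le\Delta^*$, $\limsup_{k\to\infty}\frac{\log\mathbb{E}(|X_k^\Delta|^2)}{\log(1+k\Delta)}<-\gamma$; it is almost surely polynomially stable if this is replaced by $\limsup_{k\to\infty}\frac{\log|X_k^\Delta|}{\log(1+k\Delta)}<-\gamma$ a.s. *)

theory Defs
  imports "HOL-Probability.Probability"
begin

text \<open>Matrices are \<open>real^'d^'n\<close> (\<open>n\<close> rows, \<open>d\<close> columns); the library norm on this type is the
  Frobenius (trace) norm.\<close>

lemma norm_matrix_eq_sqrt_trace:
  fixes A :: "real^'d^'n"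
  shows "norm A = sqrt (trace (transpose A ** A))"
proof -
  have "trace (transpose A ** A) = (\<Sum>j\<in>UNIV. \<Sum>i\<in>UNIV. (A $ i $ j)\<^sup>2)"
    by (simp add: trace_def matrix_matrix_mult_def transpose_def power2_eq_square)
  also have "\<dots> = (\<Sum>i\<in>UNIV. \<Sum>j\<in>UNIV. (A $ i $ j)\<^sup>2)"
    by (rule sum.swap)
  also have "\<dots> = (\<Sum>i\<in>UNIV. (norm (A $ i))\<^sup>2)"
    by (simp add: norm_vec_def L2_set_def sum_nonneg)
  finally show ?thesis
    by (simp add: norm_vec_def[of A] L2_set_def)
qed

subsection \<open>Stochastic basis and Brownian motion\<close>

text \<open>Time runs over \<open>[0,\<infinity>)\<close>: \<open>F t\<close> is irrelevant for \<open>t < 0\<close>, whence the \<open>max 0\<close> (the library's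
  locale indexes a filtration by a whole type).\<close>

definition usual_conditions :: "'a measure \<Rightarrow> (real \<Rightarrow> 'a measure) \<Rightarrow> bool" where
  "usual_conditions M F \<longleftrightarrow>
     filtration (space M) (\<lambda>t. F (max 0 t)) \<and>
     (\<forall>t\<ge>0. subalgebra M (F t)) \<and>
     (\<forall>t\<ge>0. sets (F t) = (\<Inter>s\<in>{t<..}. sets (F s))) \<and>
     null_sets M \<subseteq> sets (F 0)"

text \<open>The increments are \<open>N(0, (t - s) I)\<close>-distributed, i.e. their coordinates are independent and
  each has the normal density with mean \<open>0\<close> and standard deviation \<open>sqrt (t - s)\<close>.\<close>

definition brownian_motion ::
  "'a measure \<Rightarrow> (real \<Rightarrow> 'a measure) \<Rightarrow> (real \<Rightarrow> 'a \<Rightarrow> real^'d) \<Rightarrow> bool" where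
  "brownian_motion M F B \<longleftrightarrow>
     (\<forall>t\<ge>0. B t \<in> borel_measurable (F t)) \<and>
     (AE \<omega> in M. B 0 \<omega> = 0) \<and>
     (AE \<omega> in M. continuous_on {0..} (\<lambda>t. B t \<omega>)) \<and>
     (\<forall>s t. 0 \<le> s \<and> s < t \<longrightarrow>
        prob_space.indep_set M (sets (F s))
          (sets (vimage_algebra (space M) (\<lambda>\<omega>. B t \<omega> - B s \<omega>) borel)) \<and>
        prob_space.indep_vars M (\<lambda>_. borel) (\<lambda>i \<omega>. (B t \<omega> - B s \<omega>) $ i) UNIV \<and>
        (\<forall>i. distributed M lborel (\<lambda>\<omega>. (B t \<omega> - B s \<omega>) $ i)
               (\<lambda>x. ennreal (normal_density 0 (sqrt (t - s)) x))))"

subsection \<open>Initial segments\<close>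

text \<open>\<open>C([-\<tau>,0];\<real>\<^sup>n)\<close> with the uniform metric; its elements are \<open>undefined\<close> outside \<open>[-\<tau>,0]\<close>.\<close>

definition segment_space :: "real \<Rightarrow> (real \<Rightarrow> real^'n) metric" where
  "segment_space \<tau> = cfunspace (top_of_set {-\<tau>..0}) euclidean_metric"

definition segment_borel :: "real \<Rightarrow> (real \<Rightarrow> real^'n) measure" where
  "segment_borel \<tau> =
     sigma (mspace (segment_space \<tau>)) {U. openin (mtopology_of (segment_space \<tau>)) U}"

definition segment_norm :: "real \<Rightarrow> (real \<Rightarrow> real^'n) \<Rightarrow> real" where
  "segment_norm \<tau> \<phi> = (SUP \<theta>\<in>{-\<tau>..0}. norm (\<phi> \<theta>))"

definition bounded_initial ::
  "'a measure \<Rightarrow> (real \<Rightarrow> 'a measure) \<Rightarrow> real \<Rightarrow> ('a \<Rightarrow> real \<Rightarrow> real^'n) \<Rightarrow> bool" where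
  "bounded_initial M F \<tau> \<xi> \<longleftrightarrow>
     \<xi> \<in> F 0 \<rightarrow>\<^sub>M segment_borel \<tau> \<and> bounded ((\<lambda>\<omega>. segment_norm \<tau> (\<xi> \<omega>)) ` space M)"

subsection \<open>The modified truncated Euler--Maruyama scheme\<close>

definition truncated ::
  "(real \<Rightarrow> real) \<Rightarrow> real \<Rightarrow> (real^'n \<Rightarrow> real^'n \<Rightarrow> real \<Rightarrow> 'b::real_vector)
    \<Rightarrow> real^'n \<Rightarrow> real^'n \<Rightarrow> real \<Rightarrow> 'b" where
  "truncated h \<Delta> \<phi> x y t =
     (let r = max (norm x) (norm y) in
      if r \<le> h \<Delta> then \<phi> x y t
      else (r / h \<Delta>) *\<^sub>R \<phi> ((h \<Delta> / r) *\<^sub>R x) ((h \<Delta> / r) *\<^sub>R y) t)"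

definition step_sizes :: "real \<Rightarrow> real \<Rightarrow> real set" where
  "step_sizes \<tau> \<Delta>\<^sub>0 =
     {\<Delta>. 0 < \<Delta> \<and> \<Delta> < 1 \<and> \<Delta> \<le> \<Delta>\<^sub>0 \<and> (\<exists>m::nat. \<tau> = real m * \<Delta>)}"

text \<open>\<open>nat\<close> only serves termination: \<open>\<delta>\<close> is nonnegative on \<open>[0,\<infinity>)\<close>. If \<open>\<delta> 0 = \<tau> = m \<Delta>\<close> and
  \<open>\<delta>' \<le> \<eta> < 1\<close>, then indices below \<open>-m\<close> are never used for \<open>k \<ge> 0\<close>.\<close>

function mtem ::
  "(real^'n \<Rightarrow> real^'n \<Rightarrow> real \<Rightarrow> real^'n) \<Rightarrow> (real^'n \<Rightarrow> real^'n \<Rightarrow> real \<Rightarrow> real^'d^'n)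
    \<Rightarrow> (real \<Rightarrow> real) \<Rightarrow> (real \<Rightarrow> real) \<Rightarrow> ('a \<Rightarrow> real \<Rightarrow> real^'n) \<Rightarrow> (real \<Rightarrow> 'a \<Rightarrow> real^'d)
    \<Rightarrow> real \<Rightarrow> int \<Rightarrow> 'a \<Rightarrow> real^'n" where
  "mtem f g \<delta> h \<xi> B \<Delta> k \<omega> =
     (if k \<le> 0 then \<xi> \<omega> (real_of_int k * \<Delta>)
      else let j = k - 1; t = real_of_int j * \<Delta>;
               x = mtem f g \<delta> h \<xi> B \<Delta> j \<omega>;
               y = mtem f g \<delta> h \<xi> B \<Delta> (j - int (nat \<lfloor>\<delta> t / \<Delta>\<rfloor>)) \<omega>
           in x + \<Delta> *\<^sub>R truncated h \<Delta> f x y t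
                + truncated h \<Delta> g x y t *v (B (t + \<Delta>) \<omega> - B t \<omega>))"
  by pat_completeness auto
termination
  by (relation "Wellfounded.measure (\<lambda>(f, g, \<delta>, h, \<xi>, B, \<Delta>, k, \<omega>). nat k)") (auto simp: less_floor_iff)

declare mtem.simps [simp del]

subsection \<open>Polynomial stability\<close>

text \<open>Logarithm with \<open>log 0 = -\<infinity>\<close> (in the library \<open>ln 0 = 0\<close>). Second moments are taken as
  nonnegative integrals, so that a non-integrable \<open>|X|\<^sup>2\<close> has moment \<open>\<infinity>\<close> rather than \<open>0\<close>.\<close>

definition elog :: "ennreal \<Rightarrow> ereal" where
  "elog x = (if x = 0 then -\<infinity> else if x = \<infinity> then \<infinity> else ereal (ln (enn2real x)))"

definition ms_exponent :: "'a measure \<Rightarrow> real \<Rightarrow> (int \<Rightarrow> 'a \<Rightarrow> real^'n) \<Rightarrow> ereal" where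
  "ms_exponent M \<Delta> X =
     limsup (\<lambda>k::nat. elog (\<integral>\<^sup>+\<omega>. ennreal ((norm (X (int k) \<omega>))\<^sup>2) \<partial>M)
                       / ereal (ln (1 + real k * \<Delta>)))"

definition path_exponent :: "real \<Rightarrow> (int \<Rightarrow> 'a \<Rightarrow> real^'n) \<Rightarrow> 'a \<Rightarrow> ereal" where
  "path_exponent \<Delta> X \<omega> =
     limsup (\<lambda>k::nat. elog (ennreal (norm (X (int k) \<omega>))) / ereal (ln (1 + real k * \<Delta>)))"

text \<open>\<open>S\<close> is the set of admissible step sizes and \<open>X \<Delta>\<close> the approximation with step size \<open>\<Delta>\<close>.\<close>

definition ms_polynomially_stable ::
  "'a measure \<Rightarrow> real set \<Rightarrow> (real \<Rightarrow> int \<Rightarrow> 'a \<Rightarrow> real^'n) \<Rightarrow> bool" where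
  "ms_polynomially_stable M S X \<longleftrightarrow>
     (\<exists>\<Delta>s>0. \<exists>\<gamma>>0. \<forall>\<Delta>\<in>S. \<Delta> \<le> \<Delta>s \<longrightarrow> ms_exponent M \<Delta> (X \<Delta>) < ereal (- \<gamma>))"

definition as_polynomially_stable ::
  "'a measure \<Rightarrow> real set \<Rightarrow> (real \<Rightarrow> int \<Rightarrow> 'a \<Rightarrow> real^'n) \<Rightarrow> bool" where
  "as_polynomially_stable M S X \<longleftrightarrow>
     (\<exists>\<Delta>s>0. \<exists>\<gamma>>0. \<forall>\<Delta>\<in>S. \<Delta> \<le> \<Delta>s \<longrightarrow>
        (AE \<omega> in M. path_exponent \<Delta> (X \<Delta>) \<omega> < ereal (- \<gamma>)))"

end

theory Submission
  imports Defs
begin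

text \<open>For \<open>0 < C < 1\<close> put \<open>W\<^sub>k = (1 + k\<Delta>)\<^sup>C\<close>. Truncation and condition (v) keep the one-step energy
  estimate of the scheme as close as we like to the dissipativity condition (iii). In the resulting
  bound for \<open>W\<^sub>n |X\<^sub>n|\<^sup>2\<close> the delayed terms carry the weight \<open>(1 + k\<Delta>)\<^sup>C\<^sup>-\<^sup>1\<close>, which decreases in \<open>k\<close>, so it
  may be replaced by the weight at the delayed index; every index is hit at most \<open>[(1 - \<eta>)\<^sup>-\<^sup>1] + 1\<close>
  times because \<open>\<delta>' \<le> \<eta>\<close>, and the undelayed negative terms absorb the whole sum. This leaves the
  pathwise bound \<open>W\<^sub>n |X\<^sub>n|\<^sup>2 \<le> c + M\<^sub>n\<close> with a deterministic \<open>c\<close> and a martingale \<open>M\<close> starting at \<open>0\<close>.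
  Taking expectations gives mean square decay. As \<open>c + M\<close> is a nonnegative martingale, the maximal
  inequality bounds its paths almost surely, which gives almost sure decay.\<close>

text \<open>The obstacle is the squared drift that an Euler step adds to the energy: it is of order
  \<open>\<Delta>\<^sup>2\<close>, but (iii) offers only a gain of order
  \<open>\<Delta> / (1 + t)\<close>, which fades with time. Truncation by radial scaling gives
  global linear growth with the constant of the ball of radius \<open>h \<Delta>\<close>, so cost
  over gain is of order \<open>(1 + t) * (L (h \<Delta>) t)\<^sup>2 * \<Delta>\<close>. For
  \<open>R = h \<Delta>\<close> the inverse function in (v) returns \<open>\<Delta>\<close>, and (v)
  says that this ratio is small uniformly in \<open>t\<close>. The scaling also inflates the
  constant of (iii), but only by an error with factor \<open>K / (h \<Delta>)\<^sup>2\<close>. The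
  parameter \<open>\<epsilon>\<close> is the total loss allowed in each of
  \<open>lam\<^sub>1\<close> and \<open>lam\<^sub>2\<close>, and \<open>Ct\<^sub>0\<close> is the
  surplus that remains. The lower bound on \<open>\<epsilon>\<close> forces
  \<open>Ct\<^sub>0 < 1\<close>, which makes the weights with exponent \<open>C - 1\<close>
  decrease; \<open>C < lam\<^sub>0\<close> makes the weighted sum of the constants of (iii)
  converge.\<close>

subsection \<open>The truncated coefficients\<close>

text \<open>The argument is scaled back into the ball of radius \<open>h \<Delta>\<close> and the
  value scaled up by the inverse factor. A bound homogeneous of degree one is unchanged by this, so
  a local growth constant becomes a global one.\<close>

lemma norm_truncated_le:
  fixes \<phi> :: "real^'n \<Rightarrow> real^'n \<Rightarrow> real \<Rightarrow> 'b::real_normed_vector"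
  assumes h: "0 < h \<Delta>"
    and growth: "\<And>x y. max (norm x) (norm y) \<le> h \<Delta> \<Longrightarrow> norm (\<phi> x y t) \<le> l * (norm x + norm y)"
  shows "norm (truncated h \<Delta> \<phi> x y t) \<le> l * (norm x + norm y)"
proof -
  define r where "r = max (norm x) (norm y)"
  show ?thesis
  proof (cases "r \<le> h \<Delta>")
    case True
    then show ?thesis using growth by (simp add: truncated_def Let_def r_def)
  next
    case False
    then have r: "0 < r" "h \<Delta> < r" using h by auto
    have nx: "norm x \<le> r" and ny: "norm y \<le> r" by (auto simp: r_def)
    have "norm ((h \<Delta> / r) *\<^sub>R x) \<le> h \<Delta>" "norm ((h \<Delta> / r) *\<^sub>R y) \<le> h \<Delta>"
      using h r nx ny by (auto simp: divide_simps mult_left_mono)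
    then have "norm (\<phi> ((h \<Delta> / r) *\<^sub>R x) ((h \<Delta> / r) *\<^sub>R y) t)
        \<le> l * (norm ((h \<Delta> / r) *\<^sub>R x) + norm ((h \<Delta> / r) *\<^sub>R y))"
      by (intro growth) simp
    also have "\<dots> = (h \<Delta> / r) * (l * (norm x + norm y))"
      using h r by (simp add: algebra_simps)
    finally have *: "(r / h \<Delta>) * norm (\<phi> ((h \<Delta> / r) *\<^sub>R x) ((h \<Delta> / r) *\<^sub>R y) t)
        \<le> (r / h \<Delta>) * ((h \<Delta> / r) * (l * (norm x + norm y)))"
      using h r by (intro mult_left_mono) auto
    have "norm (truncated h \<Delta> \<phi> x y t) = (r / h \<Delta>) * norm (\<phi> ((h \<Delta> / r) *\<^sub>R x) ((h \<Delta> / r) *\<^sub>R y) t)"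
      using False r h by (simp add: truncated_def Let_def r_def[symmetric])
    also have "\<dots> \<le> l * (norm x + norm y)"
      using * h r by simp
    finally show ?thesis .
  qed
qed

text \<open>Everything except \<open>a\<close> is homogeneous of degree two. Undoing the scaling by
  \<open>s = h \<Delta> / r\<close> leaves the quadratic terms intact and turns \<open>a\<close>
  into \<open>a / (h \<Delta>)\<^sup>2 * r\<^sup>2\<close>. The two regimes are merged by adding
  both forms of the constant.\<close>

lemma truncated_dissipative:
  fixes f :: "real^'n \<Rightarrow> real^'n \<Rightarrow> real \<Rightarrow> real^'n" and g :: "real^'n \<Rightarrow> real^'n \<Rightarrow> real \<Rightarrow> real^'d^'n"
  assumes h: "0 < h \<Delta>" and a: "0 \<le> a"
    and diss: "\<And>x y. 2 * (x \<bullet> f x y t) + (norm (g x y t))\<^sup>2 \<le> a - b * (norm x)\<^sup>2 + c * (norm y)\<^sup>2"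
  shows "2 * (x \<bullet> truncated h \<Delta> f x y t) + (norm (truncated h \<Delta> g x y t))\<^sup>2
    \<le> a + a / (h \<Delta>)\<^sup>2 * ((norm x)\<^sup>2 + (norm y)\<^sup>2) - b * (norm x)\<^sup>2 + c * (norm y)\<^sup>2"
proof -
  define r where "r = max (norm x) (norm y)"
  show ?thesis
  proof (cases "r \<le> h \<Delta>")
    case True
    have "0 \<le> a / (h \<Delta>)\<^sup>2 * ((norm x)\<^sup>2 + (norm y)\<^sup>2)" using a by simp
    then show ?thesis using True diss[of x y] by (simp add: truncated_def Let_def r_def)
  next
    case False
    then have r: "0 < r" "h \<Delta> < r" using h by auto
    define s where "s = h \<Delta> / r"
    have s: "0 < s" using r h by (simp add: s_def)
    have rs: "r / h \<Delta> = 1 / s" by (simp add: s_def)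
    have f: "truncated h \<Delta> f x y t = (1 / s) *\<^sub>R f (s *\<^sub>R x) (s *\<^sub>R y) t"
      and g: "truncated h \<Delta> g x y t = (1 / s) *\<^sub>R g (s *\<^sub>R x) (s *\<^sub>R y) t"
      using False by (simp_all add: truncated_def Let_def r_def[symmetric] rs s_def[symmetric])
    have "2 * (x \<bullet> truncated h \<Delta> f x y t) + (norm (truncated h \<Delta> g x y t))\<^sup>2
       = (1 / s\<^sup>2) * (2 * ((s *\<^sub>R x) \<bullet> f (s *\<^sub>R x) (s *\<^sub>R y) t) + (norm (g (s *\<^sub>R x) (s *\<^sub>R y) t))\<^sup>2)"
      using s unfolding f g by (simp add: field_simps power2_eq_square)
    also have "\<dots> \<le> (1 / s\<^sup>2) * (a - b * (norm (s *\<^sub>R x))\<^sup>2 + c * (norm (s *\<^sub>R y))\<^sup>2)"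
      by (intro mult_left_mono diss) simp
    also have "\<dots> = a / (h \<Delta>)\<^sup>2 * r\<^sup>2 - b * (norm x)\<^sup>2 + c * (norm y)\<^sup>2"
      using s h r by (simp add: s_def power_mult_distrib field_simps)
    also have "\<dots> \<le> a / (h \<Delta>)\<^sup>2 * ((norm x)\<^sup>2 + (norm y)\<^sup>2) - b * (norm x)\<^sup>2 + c * (norm y)\<^sup>2"
    proof -
      have "r\<^sup>2 \<le> (norm x)\<^sup>2 + (norm y)\<^sup>2" by (auto simp: r_def max_def)
      then have "a / (h \<Delta>)\<^sup>2 * r\<^sup>2 \<le> a / (h \<Delta>)\<^sup>2 * ((norm x)\<^sup>2 + (norm y)\<^sup>2)"
        using a by (intro mult_left_mono) auto
      then show ?thesis by simp
    qed
    also have "\<dots> \<le> a + a / (h \<Delta>)\<^sup>2 * ((norm x)\<^sup>2 + (norm y)\<^sup>2) - b * (norm x)\<^sup>2 + c * (norm y)\<^sup>2"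
      using a by simp
    finally show ?thesis .
  qed
qed

lemma measurable_truncated:
  fixes \<phi> :: "real^'n \<Rightarrow> real^'n \<Rightarrow> real \<Rightarrow> 'b::{second_countable_topology, real_normed_vector}"
  assumes \<phi>: "(\<lambda>(x, y, t). \<phi> x y t) \<in> borel_measurable (restrict_space borel (UNIV \<times> UNIV \<times> {0..}))"
    and t: "0 \<le> t" and [measurable]: "X \<in> borel_measurable M" "Y \<in> borel_measurable M"
  shows "(\<lambda>\<omega>. truncated h \<Delta> \<phi> (X \<omega>) (Y \<omega>) t) \<in> borel_measurable M"
proof -
  have *: "(\<lambda>\<omega>. \<phi> (U \<omega>) (V \<omega>) t) \<in> borel_measurable M"
    if [measurable]: "U \<in> borel_measurable M" "V \<in> borel_measurable M" for U V
  proof -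
    have "(\<lambda>\<omega>. (U \<omega>, V \<omega>, t)) \<in> M \<rightarrow>\<^sub>M restrict_space borel (UNIV \<times> UNIV \<times> {0..})"
      using t by (intro measurable_restrict_space2) (auto simp: borel_prod[symmetric])
    from measurable_compose[OF this \<phi>] show ?thesis by simp
  qed
  have [measurable]: "(\<lambda>\<omega>. \<phi> (X \<omega>) (Y \<omega>) t) \<in> borel_measurable M"
    "(\<lambda>\<omega>. \<phi> ((h \<Delta> / max (norm (X \<omega>)) (norm (Y \<omega>))) *\<^sub>R X \<omega>)
       ((h \<Delta> / max (norm (X \<omega>)) (norm (Y \<omega>))) *\<^sub>R Y \<omega>) t) \<in> borel_measurable M"
    by (intro *; measurable)+
  show ?thesis unfolding truncated_def Let_def by measurable
qed

subsection \<open>The weighted energy estimate\<close>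

text \<open>Bernoulli's inequality, from convexity of \<open>exp\<close> between 0 and
  \<open>ln (1 + x)\<close> with weight \<open>C\<close>. It supplies the sharp rate
  \<open>C\<close> at which the weights grow.\<close>

lemma powr_one_plus_le:
  fixes x C :: real
  assumes "0 \<le> x" "0 \<le> C" "C \<le> 1"
  shows "(1 + x) powr C \<le> 1 + C * x"
proof -
  have "exp ((1 - C) *\<^sub>R 0 + C *\<^sub>R ln (1 + x)) \<le> (1 - C) * exp 0 + C * exp (ln (1 + x))"
    using assms by (intro convex_onD[OF exp_convex]) auto
  then show ?thesis using assms by (simp add: powr_def algebra_simps)
qed

lemma sum_comp_le_card_mult:
  fixes F :: "'b \<Rightarrow> real"
  assumes "finite S" "finite T" "\<And>k. k \<in> S \<Longrightarrow> i k \<in> T" "\<And>j. j \<in> T \<Longrightarrow> 0 \<le> F j"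
    and "\<And>j. j \<in> T \<Longrightarrow> card {k \<in> S. i k = j} \<le> q"
  shows "(\<Sum>k\<in>S. F (i k)) \<le> real q * (\<Sum>j\<in>T. F j)"
proof -
  have "(\<Sum>k\<in>S. F (i k)) = (\<Sum>j\<in>T. \<Sum>k\<in>{k \<in> S. i k = j}. F (i k))"
    using assms(1-3) by (subst sum.group) auto
  also have "\<dots> = (\<Sum>j\<in>T. real (card {k \<in> S. i k = j}) * F j)"
    by (intro sum.cong) auto
  also have "\<dots> \<le> (\<Sum>j\<in>T. real q * F j)"
    using assms(4,5) by (intro sum_mono mult_right_mono) auto
  finally show ?thesis by (simp add: sum_distrib_left)
qed

section \<open>How often the delayed index can hit one value\<close>

lemma increment_le_derivative_bound:
  fixes \<delta> \<delta>' :: "real \<Rightarrow> real"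
  assumes "\<And>t. 0 \<le> t \<Longrightarrow> (\<delta> has_real_derivative \<delta>' t) (at t within {0..})"
    and "\<And>t. 0 \<le> t \<Longrightarrow> \<delta>' t \<le> \<eta>" and "0 \<le> s" "s \<le> t"
  shows "\<delta> t - \<delta> s \<le> \<eta> * (t - s)"
proof (cases "s = t")
  case False
  then have "s < t" using assms by simp
  moreover have "(\<delta> has_derivative (*) (\<delta>' x)) (at x within {s..t})" if "s \<le> x" "x \<le> t" for x
    using assms(1)[of x] that assms(3)
    by (auto simp: has_field_derivative_def intro: has_derivative_subset)
  ultimately obtain x where "x \<in> {s<..<t}" "\<delta> t - \<delta> s = \<delta>' x * (t - s)"
    using mvt_simple[of s t \<delta> "\<lambda>x. (*) (\<delta>' x)"] by blast
  then show ?thesis using assms by (auto intro!: mult_right_mono)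
qed simp

text \<open>With \<open>\<eta> < 1\<close> the delay grows more slowly than time, so its value at
  step \<open>k\<close> is at most \<open>m + k\<close> steps. This keeps the recursion inside the
  interval on which the initial segment is defined.\<close>

lemma delay_index_lower_bound:
  fixes \<delta> :: "real \<Rightarrow> real"
  assumes incr: "\<And>s t. 0 \<le> s \<Longrightarrow> s \<le> t \<Longrightarrow> \<delta> t - \<delta> s \<le> \<eta> * (t - s)"
    and "\<eta> < 1" "0 < \<Delta>" "\<delta> 0 = real m * \<Delta>"
  shows "- int m \<le> int k - int (nat \<lfloor>\<delta> (real k * \<Delta>) / \<Delta>\<rfloor>)"
proof -
  have "\<delta> (real k * \<Delta>) \<le> real m * \<Delta> + \<eta> * (real k * \<Delta>)"
    using incr[of 0 "real k * \<Delta>"] assms by simp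
  also have "\<dots> \<le> real m * \<Delta> + 1 * (real k * \<Delta>)"
    using assms by (intro add_mono mult_right_mono) auto
  finally have "\<delta> (real k * \<Delta>) / \<Delta> \<le> real (m + k)"
    using assms by (simp add: field_simps)
  then have "\<lfloor>\<delta> (real k * \<Delta>) / \<Delta>\<rfloor> \<le> int (m + k)" by linarith
  then show ?thesis by linarith
qed

text \<open>Let \<open>a\<close> and \<open>b\<close> be the extreme members of a fibre. The rounded
  delays there differ by exactly \<open>b - a\<close>, so the unrounded quotients differ by more
  than \<open>b - a - 1\<close>, while the slope bound allows at most
  \<open>\<eta> * (b - a)\<close>. Hence \<open>b - a < inverse (1 - \<eta>)\<close>, and the final
  \<open>+ 1\<close> counts both endpoints of \<open>{a..b}\<close>.\<close>

lemma card_delay_fibre_le: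
  fixes \<delta> :: "real \<Rightarrow> real"
  assumes incr: "\<And>s t. 0 \<le> s \<Longrightarrow> s \<le> t \<Longrightarrow> \<delta> t - \<delta> s \<le> \<eta> * (t - s)"
    and nonneg: "\<And>t. 0 \<le> t \<Longrightarrow> 0 \<le> \<delta> t"
    and "\<eta> < 1" "0 < \<Delta>" and fin: "finite S"
  shows "card {k \<in> S. int k - int (nat \<lfloor>\<delta> (real k * \<Delta>) / \<Delta>\<rfloor>) = i} \<le> nat \<lfloor>inverse (1 - \<eta>)\<rfloor> + 1"
    (is "card ?S \<le> _")
proof (cases "?S = {}")
  case False
  have finS: "finite ?S" using fin by simp
  define a b where "a = Min ?S" and "b = Max ?S"
  have ab: "a \<in> ?S" "b \<in> ?S" "a \<le> b" "?S \<subseteq> {a..b}"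
  proof -
    show "a \<in> ?S" "b \<in> ?S" unfolding a_def b_def using finS False by (rule Min_in Max_in)+
    then show "a \<le> b" unfolding a_def using finS by (intro Min_le)
    show "?S \<subseteq> {a..b}"
    proof
      fix k assume "k \<in> ?S"
      then show "k \<in> {a..b}"
        unfolding a_def b_def using Min_le[OF finS] Max_ge[OF finS] by (simp only: atLeastAtMost_iff)
    qed
  qed
  have floor: "of_int (int k - i) \<le> \<delta> (real k * \<Delta>) / \<Delta>" "\<delta> (real k * \<Delta>) / \<Delta> < of_int (int k - i) + 1"
    if "k \<in> ?S" for k
  proof -
    \<comment> \<open>Nonnegativity ensures that \<open>nat\<close> does not clip the floor.\<close>
    have "0 \<le> \<delta> (real k * \<Delta>) / \<Delta>" using nonneg assms(4) by simp
    then have "\<lfloor>\<delta> (real k * \<Delta>) / \<Delta>\<rfloor> = int k - i"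
      using that by auto
    then show "of_int (int k - i) \<le> \<delta> (real k * \<Delta>) / \<Delta>" "\<delta> (real k * \<Delta>) / \<Delta> < of_int (int k - i) + 1"
      by (simp_all add: floor_eq_iff)
  qed
  have "\<delta> (real b * \<Delta>) - \<delta> (real a * \<Delta>) \<le> \<eta> * (real b * \<Delta> - real a * \<Delta>)"
    using ab(3) assms(4) by (intro incr) auto
  then have "\<delta> (real b * \<Delta>) / \<Delta> - \<delta> (real a * \<Delta>) / \<Delta> \<le> \<eta> * (real b - real a)"
    using assms(4) by (simp add: field_simps)
  then have "real b - real a - 1 < \<eta> * (real b - real a)"
    using floor[OF ab(1)] floor[OF ab(2)] by simp
  then have "(real b - real a) * (1 - \<eta>) < 1" by (simp add: algebra_simps)
  then have "real b - real a < inverse (1 - \<eta>)"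
    using assms(3) by (simp add: field_simps)
  then have "int b - int a \<le> \<lfloor>inverse (1 - \<eta>)\<rfloor>" by (simp add: le_floor_iff)
  moreover have "card ?S \<le> b - a + 1"
    using card_mono[OF _ ab(4)] ab(3) by simp
  ultimately show ?thesis using ab(3) by linarith
qed (simp only: card.empty)

text \<open>A deterministic energy balance, applied later to one path at a time with
  \<open>a i\<close> the squared norm and \<open>\<mu>\<close> the noise. At the scale of
  \<open>v k\<close> below, weight growth costs \<open>C\<close>, dissipation gains
  \<open>\<alpha>\<close>, and the delayed terms, once collected at their own indices, cost at most
  \<open>\<beta> * (1 + \<Delta>) * real q\<close>; the last part of \<open>coeff\<close> makes the
  total nonpositive. The initial history, the summed constants and the weighted noise
  survive.\<close>

lemma weighted_energy_bound:
  fixes a :: "int \<Rightarrow> real" and idx :: "nat \<Rightarrow> int" and \<mu> :: "nat \<Rightarrow> real"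
  assumes a0: "\<And>i. 0 \<le> a i" and \<Delta>: "0 < \<Delta>" "\<Delta> \<le> 1" and C: "0 < C" "C < 1"
    and coeff: "0 \<le> \<alpha>" "0 \<le> \<beta>" "0 \<le> K" "C + \<beta> * (1 + \<Delta>) * real q \<le> \<alpha>"
    and step: "\<And>k. k < n \<Longrightarrow> a (int k + 1) \<le> a (int k) + \<Delta> / (1 + real k * \<Delta>) *
        (K * (1 + real k * \<Delta>) powr (- p) - \<alpha> * a (int k) + \<beta> * a (idx k)) + \<mu> k"
    and idx: "\<And>k. - int m \<le> idx k" "\<And>k. idx k \<le> int k"
    and fibre: "\<And>j. card {k \<in> {..<n}. idx k = j} \<le> q"
    and init: "\<And>i. - int m \<le> i \<Longrightarrow> i \<le> 0 \<Longrightarrow> a i \<le> A"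
  shows "(1 + real n * \<Delta>) powr C * a (int n) \<le>
     A + \<beta> * (1 + \<Delta>) * real q * (\<Delta> * real m * A)
       + 2 * K * \<Delta> * (\<Sum>k<n. (1 + real k * \<Delta>) powr (C - 1 - p))
       + (\<Sum>k<n. (1 + (real k + 1) * \<Delta>) powr C * \<mu> k)"
proof -
  \<comment> \<open>\<open>C * v k\<close> is the derivative of the weight times
    \<open>\<Delta>\<close>, and \<open>v k\<close> is also \<open>W k\<close> times the factor
    \<open>\<Delta> / (1 + real k * \<Delta>)\<close> of the energy inequality. Weight growth and
    dissipation are thus measured on the same scale.\<close>
  define W where "W k = (1 + real k * \<Delta>) powr C" for k :: nat
  define v where "v k = \<Delta> * (1 + real k * \<Delta>) powr (C - 1)" for k :: nat
  define \<beta>' where "\<beta>' = \<beta> * (1 + \<Delta>)"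
  have pos: "0 < 1 + real k * \<Delta>" for k using \<Delta> by (simp add: add_pos_nonneg)
  have v0: "0 \<le> v k" for k using \<Delta> by (simp add: v_def)
  have W0: "0 \<le> W k" for k by (simp add: W_def)
  have vW: "v k = W k * (\<Delta> / (1 + real k * \<Delta>))" for k
    using pos[of k] by (simp add: v_def W_def powr_diff)
  have W1: "W (Suc k) \<le> W k + C * v k" for k
  proof -
    have "W (Suc k) = (1 + real k * \<Delta>) powr C * (1 + \<Delta> / (1 + real k * \<Delta>)) powr C"
    proof -
      have "1 + real (Suc k) * \<Delta> = (1 + real k * \<Delta>) * (1 + \<Delta> / (1 + real k * \<Delta>))"
        using pos[of k] by (simp add: field_simps)
      then show ?thesis by (simp add: W_def powr_mult)
    qed
    also have "\<dots> \<le> (1 + real k * \<Delta>) powr C * (1 + C * (\<Delta> / (1 + real k * \<Delta>)))"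
      using pos[of k] \<Delta> C by (intro mult_left_mono powr_one_plus_le) auto
    finally show ?thesis unfolding vW by (simp add: W_def algebra_simps)
  qed
  have vleW: "v k \<le> \<Delta> * W k" for k
  proof -
    have "W k * (\<Delta> / (1 + real k * \<Delta>)) \<le> W k * \<Delta>"
      using pos[of k] \<Delta> W0 by (intro mult_left_mono) (simp_all add: field_simps)
    then show ?thesis by (simp add: vW mult.commute)
  qed
  have W2: "W (Suc k) \<le> (1 + \<Delta>) * W k" for k
  proof -
    have "C * v k \<le> 1 * v k" using C v0 by (intro mult_right_mono) auto
    then show ?thesis using W1[of k] vleW[of k] by (simp add: algebra_simps)
  qed
  have Wm: "W k \<le> W (Suc k)" for k
    unfolding W_def using pos[of k] \<Delta> C by (intro powr_mono2) (auto simp: algebra_simps)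
  have rec: "W (Suc k) * a (int k + 1) \<le> W k * a (int k) + v k * ((C - \<alpha>) * a (int k) + \<beta>' * a (idx k))
       + 2 * K * \<Delta> * (1 + real k * \<Delta>) powr (C - 1 - p) + W (Suc k) * \<mu> k" if "k < n" for k
  proof -
    define e where "e = \<Delta> / (1 + real k * \<Delta>)"
    define P where "P = K * (1 + real k * \<Delta>) powr (- p)"
    have e0: "0 \<le> e" using \<Delta> pos[of k] by (simp add: e_def)
    have P0: "0 \<le> P" using coeff by (simp add: P_def)
    have "W (Suc k) * a (int k + 1) \<le> W (Suc k) * (a (int k) + e * (P - \<alpha> * a (int k) + \<beta> * a (idx k)) + \<mu> k)"
      using step[OF that] W0 by (intro mult_left_mono) (auto simp: e_def P_def)
    also have "\<dots> = W (Suc k) * a (int k) + W (Suc k) * (e * P) - W (Suc k) * (e * \<alpha> * a (int k))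
        + W (Suc k) * (e * \<beta> * a (idx k)) + W (Suc k) * \<mu> k"
      by (simp add: algebra_simps)
    \<comment> \<open>Each term passes from \<open>W (Suc k)\<close> to \<open>W k\<close> at its
      own price: the sharp \<open>C * v k\<close> for the energy, a crude factor 2 for the constant,
      nothing for the dissipative term, and \<open>1 + \<Delta>\<close> for the delayed one.\<close>
    also have "\<dots> \<le> (W k + C * v k) * a (int k) + (2 * W k) * (e * P) - W k * (e * \<alpha> * a (int k))
        + ((1 + \<Delta>) * W k) * (e * \<beta> * a (idx k)) + W (Suc k) * \<mu> k"
    proof -
      have "W (Suc k) * a (int k) \<le> (W k + C * v k) * a (int k)"
        using W1 a0 by (intro mult_right_mono)
      moreover have "W (Suc k) * (e * P) \<le> (2 * W k) * (e * P)"
      proof (intro mult_right_mono)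
        have "(1 + \<Delta>) * W k \<le> 2 * W k" using \<Delta> W0 by (intro mult_right_mono) auto
        then show "W (Suc k) \<le> 2 * W k" using W2[of k] by linarith
      qed (use e0 P0 in simp)
      moreover have "W k * (e * \<alpha> * a (int k)) \<le> W (Suc k) * (e * \<alpha> * a (int k))"
        using Wm a0 e0 coeff by (intro mult_right_mono) auto
      moreover have "W (Suc k) * (e * \<beta> * a (idx k)) \<le> ((1 + \<Delta>) * W k) * (e * \<beta> * a (idx k))"
        using W2 a0 e0 coeff by (intro mult_right_mono) auto
      ultimately show ?thesis by linarith
    qed
    also have "(2 * W k) * (e * P) = 2 * K * \<Delta> * (1 + real k * \<Delta>) powr (C - 1 - p)"
    proof -
      have "(1 + real k * \<Delta>) powr (C - 1 - p) = W k / (1 + real k * \<Delta>) * (1 + real k * \<Delta>) powr (- p)"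
        using pos[of k] by (simp add: W_def powr_diff powr_minus divide_inverse)
      then show ?thesis by (simp add: e_def P_def)
    qed
    finally show ?thesis unfolding vW e_def[symmetric] \<beta>'_def by (simp add: algebra_simps)
  qed
  have tele: "j \<le> n \<Longrightarrow> W j * a (int j) \<le> a 0 + (\<Sum>k<j. v k * ((C - \<alpha>) * a (int k) + \<beta>' * a (idx k)))
       + 2 * K * \<Delta> * (\<Sum>k<j. (1 + real k * \<Delta>) powr (C - 1 - p)) + (\<Sum>k<j. W (Suc k) * \<mu> k)" for j
  proof (induction j)
    case 0
    then show ?case by (simp add: W_def)
  next
    case (Suc j)
    then show ?case using rec[of j] by (simp add: algebra_simps)
  qed
  \<comment> \<open>\<open>nat\<close> sends negative indices to 0, so the initial history carries
    the constant weight \<open>v 0 = \<Delta>\<close>; this is the origin of the term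
    \<open>\<Delta> * real m * A\<close>.\<close>
  define V where "V i = v (nat i)" for i
  have delay: "(\<Sum>k<n. v k * a (idx k)) \<le> real q * ((\<Sum>k<n. v k * a (int k)) + \<Delta> * real m * A)"
  proof -
    have "(\<Sum>k<n. v k * a (idx k)) \<le> (\<Sum>k<n. V (idx k) * a (idx k))"
    proof (intro sum_mono mult_right_mono a0)
      fix k
      have "real (nat (idx k)) * \<Delta> \<le> real k * \<Delta>"
        using idx(2)[of k] \<Delta> by (intro mult_right_mono) auto
      then show "v k \<le> V (idx k)"
        unfolding v_def V_def using \<Delta> C pos by (intro mult_left_mono powr_mono2') auto
    qed
    also have "\<dots> \<le> real q * (\<Sum>i\<in>{- int m..<int n}. V i * a i)"
    proof (rule sum_comp_le_card_mult[where F = "\<lambda>i. V i * a i" and i = idx])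
      show "idx k \<in> {- int m..<int n}" if "k \<in> {..<n}" for k
        using idx[of k] that by auto
    qed (use fibre v0 a0 in \<open>auto simp: V_def\<close>)
    also have "(\<Sum>i\<in>{- int m..<int n}. V i * a i) =
        (\<Sum>i\<in>{- int m..<0}. V i * a i) + (\<Sum>i\<in>{0..<int n}. V i * a i)"
      by (subst sum.union_disjoint[symmetric]) (auto intro!: sum.cong)
    also have "(\<Sum>i\<in>{0..<int n}. V i * a i) = (\<Sum>k<n. v k * a (int k))"
      by (rule sum.reindex_bij_witness[of _ int nat]) (auto simp: V_def)
    also have "real q * ((\<Sum>i\<in>{- int m..<0}. V i * a i) + (\<Sum>k<n. v k * a (int k)))
        \<le> real q * ((\<Sum>i\<in>{- int m..<0}. \<Delta> * A) + (\<Sum>k<n. v k * a (int k)))"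
      using init \<Delta> by (intro mult_left_mono add_right_mono sum_mono) (auto simp: V_def v_def)
    finally show ?thesis by (simp add: algebra_simps)
  qed
  have "(\<Sum>k<n. v k * ((C - \<alpha>) * a (int k) + \<beta>' * a (idx k))) =
     (C - \<alpha>) * (\<Sum>k<n. v k * a (int k)) + \<beta>' * (\<Sum>k<n. v k * a (idx k))"
    by (simp add: sum_distrib_left sum.distrib[symmetric] algebra_simps)
  also have "\<dots> \<le> (C - \<alpha>) * (\<Sum>k<n. v k * a (int k))
      + \<beta>' * (real q * ((\<Sum>k<n. v k * a (int k)) + \<Delta> * real m * A))"
    using coeff \<Delta> by (intro add_left_mono mult_left_mono delay) (auto simp: \<beta>'_def)
  also have "\<dots> = (C - \<alpha> + \<beta>' * real q) * (\<Sum>k<n. v k * a (int k)) + \<beta>' * real q * (\<Delta> * real m * A)"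
    by (simp add: algebra_simps)
  \<comment> \<open>By \<open>coeff\<close> the factor of the undelayed sum is at most 0, and the
    sum itself is nonnegative.\<close>
  also have "\<dots> \<le> 0 + \<beta>' * real q * (\<Delta> * real m * A)"
    using coeff v0 a0 by (intro add_right_mono mult_nonpos_nonneg sum_nonneg) (auto simp: \<beta>'_def)
  finally have main: "(\<Sum>k<n. v k * ((C - \<alpha>) * a (int k) + \<beta>' * a (idx k))) \<le> \<beta>' * real q * (\<Delta> * real m * A)"
    by simp
  have "a 0 \<le> A" by (rule init) auto
  moreover have "W (Suc k) = (1 + (real k + 1) * \<Delta>) powr C" for k
    by (simp add: W_def add.commute)
  ultimately show ?thesis
    using tele[of n] main unfolding \<beta>'_def by (simp add: W_def[of n])
qed

section \<open>Power sums and polynomial exponents\<close>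

lemma summable_powr_arith_progression:
  fixes \<Delta> s :: real
  assumes "0 < \<Delta>" "s < -1"
  shows "summable (\<lambda>k. (1 + real k * \<Delta>) powr s)"
proof (rule summable_comparison_test_ev)
  show "summable (\<lambda>k. \<Delta> powr s * real k powr s)"
    using assms by (intro summable_mult) (simp add: summable_real_powr_iff)
  \<comment> \<open>Index 0 is excluded because \<open>0 powr s\<close> is 0, whereas the left side
    is 1 there.\<close>
  have "norm ((1 + real k * \<Delta>) powr s) \<le> \<Delta> powr s * real k powr s" if "k > 0" for k
  proof -
    have "(1 + real k * \<Delta>) powr s \<le> (\<Delta> * real k) powr s"
      using assms that by (intro powr_mono2') auto
    then show ?thesis using assms by (simp add: powr_mult)
  qed
  then show "eventually (\<lambda>k. norm ((1 + real k * \<Delta>) powr s) \<le> \<Delta> powr s * real k powr s) sequentially"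
    by (auto intro: eventually_mono[OF eventually_gt_at_top[of 0]])
qed

text \<open>After division by \<open>ln (1 + real n * \<Delta>)\<close>, which tends to infinity,
  the constant \<open>c\<close> contributes a vanishing term and only the exponent remains.\<close>

lemma limsup_elog_le:
  fixes x :: "nat \<Rightarrow> ennreal"
  assumes "0 < \<Delta>" "0 < c" and x: "\<And>n. x n \<le> ennreal (c * (1 + real n * \<Delta>) powr (- r))"
  shows "limsup (\<lambda>n. elog (x n) / ereal (ln (1 + real n * \<Delta>))) \<le> ereal (- r)"
proof -
  define T where "T n = ln (1 + real n * \<Delta>)" for n
  have "filterlim T at_top sequentially"
    unfolding T_def using assms(1)
    by (intro filterlim_compose[OF ln_at_top] filterlim_tendsto_add_at_top[OF tendsto_const]
        filterlim_at_top_mult_tendsto_pos[OF tendsto_const] filterlim_real_sequentially)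
  then have "(\<lambda>n. ln c / T n - r) \<longlonglongrightarrow> 0 - r"
    by (intro tendsto_diff tendsto_const real_tendsto_divide_at_top) auto
  then have "(\<lambda>n. ereal (ln c / T n - r)) \<longlonglongrightarrow> ereal (- r)" by simp
  then have lim: "limsup (\<lambda>n. ereal (ln c / T n - r)) = ereal (- r)"
    by (intro lim_imp_Limsup) auto
  \<comment> \<open>At \<open>n = 0\<close> the denominator is 0; the limsup ignores that index. A
    vanishing \<open>x n\<close> is treated separately, its \<open>elog\<close> being minus
    infinity.\<close>
  have "elog (x n) / ereal (T n) \<le> ereal (ln c / T n - r)" if "n > 0" for n
  proof -
    have T: "0 < T n" unfolding T_def using that assms by (intro ln_gt_zero) simp
    have fin: "x n < \<infinity>" using x[of n] by (metis ennreal_less_top infinity_ennreal_def order_le_less_trans)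
    show ?thesis
    proof (cases "x n = 0")
      case True
      then show ?thesis using T by (simp add: elog_def)
    next
      case False
      define y where "y = enn2real (x n)"
      have xy: "x n = ennreal y" using fin by (simp add: y_def)
      have y: "0 < y" using False fin by (simp add: y_def enn2real_positive_iff zero_less_iff_neq_zero)
      have P: "0 < 1 + real n * \<Delta>" using assms by (simp add: add_pos_nonneg)
      have "y \<le> c * (1 + real n * \<Delta>) powr (- r)"
        using x[of n] assms unfolding xy by (subst (asm) ennreal_le_iff) auto
      then have "ln y \<le> ln (c * (1 + real n * \<Delta>) powr (- r))"
        using y by (subst ln_le_cancel_iff) auto
      also have "\<dots> = ln c - r * T n"
        using assms P by (simp add: ln_mult ln_powr T_def)
      finally have "ln y / T n \<le> (ln c - r * T n) / T n" using T by (intro divide_right_mono) auto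
      also have "\<dots> = ln c / T n - r" using T by (simp add: field_simps)
      finally show ?thesis
        using False fin T by (simp add: elog_def y_def[symmetric] top.not_eq_extremum less_top)
    qed
  qed
  then have "limsup (\<lambda>n. elog (x n) / ereal (T n)) \<le> limsup (\<lambda>n. ereal (ln c / T n - r))"
    by (intro Limsup_mono eventually_mono[OF eventually_gt_at_top[of 0]]) auto
  then show ?thesis using lim by (simp add: T_def)
qed

subsection \<open>Martingales and Gaussian increments\<close>

text \<open>Ville's inequality, by induction on the horizon: the event of having crossed the level \<open>l\<close> is
  paid for by the part of the expectation that is stopped there.\<close>

lemma (in prob_space) maximal_inequality:
  fixes Y :: "nat \<Rightarrow> 'a \<Rightarrow> real"
  assumes sub: "\<And>k. subalgebra M (G k)" and mono: "\<And>k. sets (G k) \<subseteq> sets (G (Suc k))"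
    and adapted: "\<And>k. Y k \<in> borel_measurable (G k)"
    and int: "\<And>k. integrable M (Y k)" and nonneg: "\<And>k \<omega>. \<omega> \<in> space M \<Longrightarrow> 0 \<le> Y k \<omega>"
    and mart: "\<And>k A. A \<in> sets (G k) \<Longrightarrow> (\<integral>\<omega>. indicator A \<omega> * (Y (Suc k) \<omega> - Y k \<omega>) \<partial>M) = 0"
  shows "l * prob {\<omega> \<in> space M. \<exists>k\<le>n. l \<le> Y k \<omega>} \<le> expectation (Y 0)"
proof -
  define E where "E n = {\<omega> \<in> space M. \<exists>k\<le>n. l \<le> Y k \<omega>}" for n
  define D where "D n = space M - E n" for n
  have spG: "space (G k) = space M" for k using sub by (simp add: subalgebra_def)
  have monoG: "sets (G j) \<subseteq> sets (G k)" if "j \<le> k" for j k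
    using lift_Suc_mono_le[of "\<lambda>k. sets (G k)"] mono that by blast
  have EG: "E n \<in> sets (G n)" for n
  proof -
    have "{\<omega> \<in> space M. l \<le> Y k \<omega>} \<in> sets (G n)" if "k \<le> n" for k
    proof -
      have "{\<omega> \<in> space (G k). l \<le> Y k \<omega>} \<in> sets (G k)"
        using adapted[of k] by measurable
      then show ?thesis using monoG[OF that] by (auto simp: spG)
    qed
    moreover have "E n = (\<Union>k\<in>{..n}. {\<omega> \<in> space M. l \<le> Y k \<omega>})" by (auto simp: E_def)
    ultimately show ?thesis by auto
  qed
  have DG: "D n \<in> sets (G n)" for n
    using EG[of n] sets.compl_sets[of "E n" "G n"] by (simp add: D_def spG)
  have GM: "sets (G n) \<subseteq> sets M" for n using sub by (simp add: subalgebra_def)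
  have E_ev [measurable]: "E n \<in> events" and D_ev [measurable]: "D n \<in> events" for n using EG DG GM by blast+
  have intI: "integrable M (\<lambda>\<omega>. indicator A \<omega> * Y k \<omega>)" if "A \<in> events" for A k
    using integrable_mult_indicator[OF that int[of k]] by simp
  have bound: "l * prob A + (\<integral>\<omega>. indicator B \<omega> * Y k \<omega> \<partial>M) \<le> (\<integral>\<omega>. indicator (A \<union> B) \<omega> * Y k \<omega> \<partial>M)"
    if [measurable]: "A \<in> events" "B \<in> events" and "A \<inter> B = {}" and "\<And>\<omega>. \<omega> \<in> A \<Longrightarrow> l \<le> Y k \<omega>" for A B k
  proof -
    have "l * prob A + (\<integral>\<omega>. indicator B \<omega> * Y k \<omega> \<partial>M) = (\<integral>\<omega>. l * indicator A \<omega> + indicator B \<omega> * Y k \<omega> \<partial>M)"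
      using intI[of B k] by (subst Bochner_Integration.integral_add) (auto simp: emeasure_eq_measure)
    also have "\<dots> \<le> (\<integral>\<omega>. indicator (A \<union> B) \<omega> * Y k \<omega> \<partial>M)"
      using that(3,4) intI[of B k] intI[of "A \<union> B" k]
      by (intro integral_mono Bochner_Integration.integrable_add integrable_mult_right integrable_real_indicator)
        (auto simp: emeasure_eq_measure, auto simp: indicator_def)
    finally show ?thesis .
  qed
  \<comment> \<open>The induction carries along the integral over \<open>D n\<close>, the paths
    still below \<open>l\<close>. Since \<open>D n\<close> lies in \<open>sets (G n)\<close>, the
    martingale property moves that integral to time \<open>Suc n\<close>, where it pays for the
    first crossings.\<close>
  have "l * prob (E n) + (\<integral>\<omega>. indicator (D n) \<omega> * Y n \<omega> \<partial>M) \<le> expectation (Y 0)"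
  proof (induction n)
    case 0
    have "l * prob (E 0) + (\<integral>\<omega>. indicator (D 0) \<omega> * Y 0 \<omega> \<partial>M) \<le> (\<integral>\<omega>. indicator (E 0 \<union> D 0) \<omega> * Y 0 \<omega> \<partial>M)"
      by (rule bound[OF E_ev D_ev]) (auto simp: E_def D_def)
    also have "\<dots> = expectation (Y 0)"
      by (intro Bochner_Integration.integral_cong) (auto simp: D_def indicator_def)
    finally show ?case .
  next
    case (Suc n)
    have EE: "E n \<subseteq> E (Suc n)" by (auto simp: E_def intro: le_SucI)
    have "(\<integral>\<omega>. indicator (D n) \<omega> * Y n \<omega> \<partial>M) = (\<integral>\<omega>. indicator (D n) \<omega> * Y (Suc n) \<omega> \<partial>M)"
      using mart[OF DG[of n]] intI[of "D n" n] intI[of "D n" "Suc n"]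
      by (simp add: right_diff_distrib)
    moreover have "l * prob (E (Suc n) - E n) + (\<integral>\<omega>. indicator (D (Suc n)) \<omega> * Y (Suc n) \<omega> \<partial>M)
      \<le> (\<integral>\<omega>. indicator ((E (Suc n) - E n) \<union> D (Suc n)) \<omega> * Y (Suc n) \<omega> \<partial>M)"
      by (rule bound[OF sets.Diff[OF E_ev E_ev] D_ev]) (auto simp: E_def D_def le_Suc_eq)
    moreover have "(E (Suc n) - E n) \<union> D (Suc n) = D n"
      using EE by (auto simp: D_def) (auto simp: E_def)
    moreover have "prob (E (Suc n)) = prob (E n) + prob (E (Suc n) - E n)"
      using EE by (subst finite_measure_Diff) auto
    ultimately show ?case using Suc by (simp add: distrib_left)
  qed
  moreover have "0 \<le> (\<integral>\<omega>. indicator (D n) \<omega> * Y n \<omega> \<partial>M)"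
    using nonneg by (intro integral_nonneg_AE) auto
  ultimately show ?thesis by (simp add: E_def)
qed

text \<open>Continuity from below extends the maximal inequality to the infinite horizon: a level
  \<open>l > 0\<close> is ever reached with probability at most
  \<open>expectation (Y 0) / l\<close>, which tends to 0. The martingale property is phrased by
  integrals over sets of \<open>G k\<close>, so no conditional expectations occur.\<close>

lemma (in prob_space) nonneg_martingale_bdd_above:
  fixes Y :: "nat \<Rightarrow> 'a \<Rightarrow> real"
  assumes sub: "\<And>k. subalgebra M (G k)" and mono: "\<And>k. sets (G k) \<subseteq> sets (G (Suc k))"
    and adapted: "\<And>k. Y k \<in> borel_measurable (G k)"
    and int: "\<And>k. integrable M (Y k)" and nonneg: "\<And>k \<omega>. \<omega> \<in> space M \<Longrightarrow> 0 \<le> Y k \<omega>"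
    and mart: "\<And>k A. A \<in> sets (G k) \<Longrightarrow> (\<integral>\<omega>. indicator A \<omega> * (Y (Suc k) \<omega> - Y k \<omega>) \<partial>M) = 0"
  shows "AE \<omega> in M. bdd_above (range (\<lambda>k. Y k \<omega>))"
proof -
  have [measurable]: "Y k \<in> borel_measurable M" for k using int[of k] by simp
  define E where "E l n = {\<omega> \<in> space M. \<exists>k\<le>n. real l \<le> Y k \<omega>}" for l n :: nat
  define U where "U l = {\<omega> \<in> space M. \<exists>k. real l \<le> Y k \<omega>}" for l :: nat
  define Z where "Z = (\<Inter>l. U l)"
  have [measurable]: "E l n \<in> events" "U l \<in> events" for l n unfolding E_def U_def by measurable
  have [measurable]: "Z \<in> events" unfolding Z_def by measurable
  have U: "real l * prob (U l) \<le> expectation (Y 0)" for l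
  proof -
    have "U l = (\<Union>n. E l n)" by (auto simp: U_def E_def)
    moreover have "incseq (E l)" by (auto simp: E_def incseq_def intro: order_trans)
    ultimately have "(\<lambda>n. prob (E l n)) \<longlonglongrightarrow> prob (U l)"
      using finite_Lim_measure_incseq[of "E l"] by (simp add: image_subset_iff)
    then have "(\<lambda>n. real l * prob (E l n)) \<longlonglongrightarrow> real l * prob (U l)" by (intro tendsto_mult tendsto_const)
    then show ?thesis
      using maximal_inequality[where Y = Y and G = G, OF sub mono adapted int nonneg mart, of "real l"] by (intro LIMSEQ_le_const2) (auto simp: E_def)
  qed
  have "prob Z \<le> expectation (Y 0) / real l" if "l > 0" for l
  proof -
    have "prob Z \<le> prob (U l)" by (intro finite_measure_mono) (auto simp: Z_def)
    also have "\<dots> \<le> expectation (Y 0) / real l" using U[of l] that by (simp add: field_simps)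
    finally show ?thesis .
  qed
  then have "prob Z \<le> 0"
    by (intro LIMSEQ_le_const[OF lim_const_over_n[of "expectation (Y 0)"]]) (auto intro!: exI[of _ 1])
  then have "emeasure M Z = 0" by (simp add: emeasure_eq_measure measure_le_0_iff)
  then have "AE \<omega> in M. \<omega> \<notin> Z" by (intro AE_not_in) (simp add: null_sets_def)
  then show ?thesis
  proof (rule AE_mp, intro AE_I2 impI)
    fix \<omega> assume "\<omega> \<in> space M" "\<omega> \<notin> Z"
    then obtain l where "\<And>k. Y k \<omega> < real l" by (auto simp: Z_def U_def not_le)
    then show "bdd_above (range (\<lambda>k. Y k \<omega>))" by (intro bdd_aboveI[of _ "real l"]) (auto intro: less_imp_le)
  qed
qed

text \<open>\<open>U\<close> is measurable for \<open>G\<close> and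
  \<open>\<phi> (D \<omega>)\<close> for the sigma-algebra of \<open>D\<close>, so the mean
  factorises. The function \<open>\<phi>\<close> lets one independence statement about the vector
  \<open>D\<close> serve both linear and quadratic expressions in its coordinates; independence also
  yields integrability of the product from that of the factors.\<close>

lemma (in prob_space) indep_mult_centred:
  fixes D :: "'a \<Rightarrow> 'b::topological_space" and U :: "'a \<Rightarrow> real" and \<phi> :: "'b \<Rightarrow> real"
  assumes sub: "subalgebra M G"
    and ind: "indep_set (sets G) (sets (vimage_algebra (space M) D borel))"
    and D[measurable]: "D \<in> borel_measurable M"
    and U: "U \<in> borel_measurable G" "integrable M U"
    and [measurable]: "\<phi> \<in> borel_measurable borel"
    and \<phi>: "integrable M (\<lambda>\<omega>. \<phi> (D \<omega>))" "(\<integral>\<omega>. \<phi> (D \<omega>) \<partial>M) = 0"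
  shows "integrable M (\<lambda>\<omega>. U \<omega> * \<phi> (D \<omega>))" and "(\<integral>\<omega>. U \<omega> * \<phi> (D \<omega>) \<partial>M) = 0"
proof -
  have spG: "space G = space M" using sub by (simp add: subalgebra_def)
  have "indep_var borel U borel (\<lambda>\<omega>. \<phi> (D \<omega>))"
    unfolding indep_var_eq
  proof (intro conjI)
    show "random_variable borel U" using U(2) by simp
    show "random_variable borel (\<lambda>\<omega>. \<phi> (D \<omega>))" by measurable
    have "sigma_sets (space M) {U -` A \<inter> space M |A. A \<in> sets borel} \<subseteq> sets G"
      using U(1) unfolding spG[symmetric] by (intro sets.sigma_sets_subset) (auto simp: measurable_sets)
    moreover have "sigma_sets (space M) {(\<lambda>\<omega>. \<phi> (D \<omega>)) -` A \<inter> space M |A. A \<in> sets borel}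
       \<subseteq> sets (vimage_algebra (space M) D borel)"
    proof -
      have "(\<lambda>\<omega>. \<phi> (D \<omega>)) \<in> borel_measurable (vimage_algebra (space M) D borel)"
        by (rule measurable_compose[OF measurable_vimage_algebra1]) auto
      then have "{(\<lambda>\<omega>. \<phi> (D \<omega>)) -` A \<inter> space M |A. A \<in> sets borel} \<subseteq> sets (vimage_algebra (space M) D borel)"
        by (force dest: measurable_sets)
      from sets.sigma_sets_subset[OF this] show ?thesis by simp
    qed
    ultimately show "indep_set (sigma_sets (space M) {U -` A \<inter> space M |A. A \<in> sets borel})
        (sigma_sets (space M) {(\<lambda>\<omega>. \<phi> (D \<omega>)) -` A \<inter> space M |A. A \<in> sets borel})"
      using ind unfolding indep_set_def by (rule_tac indep_sets_mono_sets) (auto split: bool.split)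
  qed
  from indep_var_integrable[OF this U(2) \<phi>(1)] indep_var_lebesgue_integral[OF this U(2) \<phi>(1)] \<phi>(2)
  show "integrable M (\<lambda>\<omega>. U \<omega> * \<phi> (D \<omega>))" "(\<integral>\<omega>. U \<omega> * \<phi> (D \<omega>) \<partial>M) = 0" by simp_all
qed

section \<open>Quadratic functions of Gaussian increments\<close>

lemma (in prob_space) normal_moments:
  assumes \<sigma>: "0 < \<sigma>" and Z: "distributed M lborel Z (\<lambda>x. ennreal (normal_density 0 \<sigma> x))"
  shows "integrable M Z" "expectation Z = 0" "integrable M (\<lambda>\<omega>. (Z \<omega>)\<^sup>2)" "(\<integral>\<omega>. (Z \<omega>)\<^sup>2 \<partial>M) = \<sigma>\<^sup>2"
proof -
  show "integrable M Z"
    using distributed_integrable[OF Z, of "\<lambda>x. x"] integrable_normal_moment_nz_1[OF \<sigma>, of 0] by simp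
  show E: "expectation Z = 0" by (rule normal_distributed_expectation[OF \<sigma> Z])
  show "integrable M (\<lambda>\<omega>. (Z \<omega>)\<^sup>2)"
    using distributed_integrable[OF Z, of "\<lambda>x. x^2"] integrable_normal_moment[OF \<sigma>, of 0 2] by simp
  show "(\<integral>\<omega>. (Z \<omega>)\<^sup>2 \<partial>M) = \<sigma>\<^sup>2"
    using normal_distributed_variance[OF \<sigma> Z] E by simp
qed

text \<open>An expansion into coefficients free of \<open>D\<close> times polynomials that are
  centred as soon as the coordinates of \<open>D\<close> are independent with mean 0 and variance
  \<open>s\<close>. As the matrix norm is the Frobenius norm, the diagonal corrections add up to
  \<open>(norm A)\<^sup>2 * s\<close>.\<close>

lemma norm_mult_vec_square:
  fixes A :: "real^'d^'n" and D :: "real^'d" and u :: "real^'n"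
  shows "(norm (A *v D))\<^sup>2 - (norm A)\<^sup>2 * s + 2 * (u \<bullet> (A *v D)) =
    (\<Sum>j\<in>UNIV. \<Sum>l\<in>UNIV. (\<Sum>i\<in>UNIV. A $ i $ j * A $ i $ l) * (D $ j * D $ l - (if j = l then s else 0)))
    + (\<Sum>j\<in>UNIV. (\<Sum>i\<in>UNIV. 2 * u $ i * A $ i $ j) * D $ j)"
proof -
  have 1: "(norm (A *v D))\<^sup>2 = (\<Sum>j\<in>UNIV. \<Sum>l\<in>UNIV. (\<Sum>i\<in>UNIV. A $ i $ j * A $ i $ l) * (D $ j * D $ l))"
  proof -
    have "(norm (A *v D))\<^sup>2 = (\<Sum>i\<in>UNIV. (\<Sum>j\<in>UNIV. A $ i $ j * D $ j) * (\<Sum>l\<in>UNIV. A $ i $ l * D $ l))"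
      by (simp add: power2_norm_eq_inner inner_vec_def matrix_vector_mult_def)
    also have "\<dots> = (\<Sum>i\<in>UNIV. \<Sum>j\<in>UNIV. \<Sum>l\<in>UNIV. (A $ i $ j * A $ i $ l) * (D $ j * D $ l))"
      by (simp add: sum_product algebra_simps)
    also have "\<dots> = (\<Sum>j\<in>UNIV. \<Sum>l\<in>UNIV. \<Sum>i\<in>UNIV. (A $ i $ j * A $ i $ l) * (D $ j * D $ l))"
      by (subst sum.swap) (intro sum.cong refl sum.swap)
    finally show ?thesis by (simp add: sum_distrib_right)
  qed
  have 2: "(norm A)\<^sup>2 * s = (\<Sum>j\<in>UNIV. \<Sum>l\<in>UNIV. (\<Sum>i\<in>UNIV. A $ i $ j * A $ i $ l) * (if j = l then s else 0))"
  proof -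
    have "(norm A)\<^sup>2 = (\<Sum>i\<in>UNIV. \<Sum>j\<in>UNIV. A $ i $ j * A $ i $ j)"
      by (simp add: power2_norm_eq_inner inner_vec_def)
    also have "\<dots> = (\<Sum>j\<in>UNIV. \<Sum>i\<in>UNIV. A $ i $ j * A $ i $ j)" by (rule sum.swap)
    finally show ?thesis by (simp add: sum_distrib_right if_distrib cong: if_cong)
  qed
  have 3: "2 * (u \<bullet> (A *v D)) = (\<Sum>j\<in>UNIV. (\<Sum>i\<in>UNIV. 2 * u $ i * A $ i $ j) * D $ j)"
  proof -
    have "2 * (u \<bullet> (A *v D)) = (\<Sum>i\<in>UNIV. \<Sum>j\<in>UNIV. 2 * u $ i * A $ i $ j * D $ j)"
      by (simp add: inner_vec_def matrix_vector_mult_def sum_distrib_left algebra_simps)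
    also have "\<dots> = (\<Sum>j\<in>UNIV. \<Sum>i\<in>UNIV. 2 * u $ i * A $ i $ j * D $ j)" by (rule sum.swap)
    finally show ?thesis by (simp add: sum_distrib_right)
  qed
  show ?thesis unfolding 1 2 3 by (simp add: right_diff_distrib sum_subtractf)
qed

text \<open>By \<open>norm_mult_vec_square\<close>, \<open>q\<close> is a finite sum of
  \<open>G\<close>-measurable coefficients times centred functions of \<open>D\<close>, each handled
  by \<open>indep_mult_centred\<close>. The coefficients are quadratic in \<open>u\<close> and
  \<open>A\<close>, so second moments make them integrable.\<close>

lemma (in prob_space) gaussian_quadratic_centred:
  fixes D :: "'a \<Rightarrow> real^'d::finite" and A :: "'a \<Rightarrow> real^'d^'n::finite" and u :: "'a \<Rightarrow> real^'n"
  assumes sub: "subalgebra M G"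
    and ind: "indep_set (sets G) (sets (vimage_algebra (space M) D borel))"
    and coord: "indep_vars (\<lambda>_. borel) (\<lambda>j \<omega>. D \<omega> $ j) UNIV"
    and \<sigma>: "0 < \<sigma>"
    and normal: "\<And>j. distributed M lborel (\<lambda>\<omega>. D \<omega> $ j) (\<lambda>x. ennreal (normal_density 0 \<sigma> x))"
    and D[measurable]: "D \<in> borel_measurable M"
    and u: "u \<in> borel_measurable G" "integrable M (\<lambda>\<omega>. (norm (u \<omega>))\<^sup>2)"
    and A: "A \<in> borel_measurable G" "integrable M (\<lambda>\<omega>. (norm (A \<omega>))\<^sup>2)"
  defines "q \<equiv> \<lambda>\<omega>. (norm (A \<omega> *v D \<omega>))\<^sup>2 - (norm (A \<omega>))\<^sup>2 * \<sigma>\<^sup>2 + 2 * (u \<omega> \<bullet> (A \<omega> *v D \<omega>))"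
  shows "integrable M q" and "S \<in> sets G \<Longrightarrow> (\<integral>\<omega>. indicator S \<omega> * q \<omega> \<partial>M) = 0"
proof -
  have GM: "f \<in> borel_measurable G \<Longrightarrow> f \<in> borel_measurable M" for f :: "'a \<Rightarrow> 'z::topological_space"
    using measurable_from_subalg[OF sub] by blast
  have [measurable]: "u \<in> borel_measurable M" "A \<in> borel_measurable M" using u A GM by blast+
  note comp [simp] = normal_moments[OF \<sigma> normal]
  \<comment> \<open>On the diagonal this is the variance; off it, a product of independent
    coordinates with mean 0.\<close>
  have \<phi>: "integrable M (\<lambda>\<omega>. D \<omega> $ j * D \<omega> $ l - (if j = l then \<sigma>\<^sup>2 else 0)) \<and>
      (\<integral>\<omega>. D \<omega> $ j * D \<omega> $ l - (if j = l then \<sigma>\<^sup>2 else 0) \<partial>M) = 0" for j l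
  proof (cases "j = l")
    case True
    then show ?thesis using comp(3,4)[of l] by (simp add: power2_eq_square prob_space)
  next
    case False
    note pair = indep_vars_subset[OF coord, of "{j, l}"]
    from indep_vars_integrable[OF _ pair] indep_vars_lebesgue_integral[OF _ pair] False
    show ?thesis by simp
  qed
  have nth_norm: "\<bar>A \<omega> $ i $ j\<bar> \<le> norm (A \<omega>)" for \<omega> i j
    by (rule order_trans[OF component_le_norm_cart Finite_Cartesian_Product.norm_nth_le])
  define c where "c j l \<omega> = (\<Sum>i\<in>UNIV. A \<omega> $ i $ j * A \<omega> $ i $ l)" for j l \<omega>
  define b where "b j \<omega> = (\<Sum>i\<in>UNIV. 2 * u \<omega> $ i * A \<omega> $ i $ j)" for j \<omega>
  have nth_meas [measurable (raw)]: "(\<lambda>\<omega>. A' \<omega> $ i $ j) \<in> borel_measurable N"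
    if "A' \<in> borel_measurable N" for A' :: "'a \<Rightarrow> real^'d^'n" and N i j
    using that by (rule borel_measurable_continuous_on[rotated]) (intro continuous_intros)
  have nth_meas' [measurable (raw)]: "(\<lambda>\<omega>. u' \<omega> $ i) \<in> borel_measurable N"
    if "u' \<in> borel_measurable N" for u' :: "'a \<Rightarrow> real^'n" and N i
    using that by (rule borel_measurable_continuous_on[rotated]) (intro continuous_intros)
  have cG: "c j l \<in> borel_measurable G" and bG: "b j \<in> borel_measurable G" for j l
    using u(1) A(1) unfolding c_def b_def by measurable
  have cI: "integrable M (c j l)" for j l
    unfolding c_def
  proof (intro Bochner_Integration.integrable_sum Bochner_Integration.integrable_bound[OF A(2)] AE_I2)
    fix i \<omega>
    have "\<bar>A \<omega> $ i $ j\<bar> * \<bar>A \<omega> $ i $ l\<bar> \<le> norm (A \<omega>) * norm (A \<omega>)"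
      by (intro mult_mono nth_norm) auto
    then show "norm (A \<omega> $ i $ j * A \<omega> $ i $ l) \<le> norm ((norm (A \<omega>))\<^sup>2)"
      by (simp add: abs_mult power2_eq_square)
  qed measurable
  have bI: "integrable M (b j)" for j
    unfolding b_def
  proof (intro Bochner_Integration.integrable_sum
      Bochner_Integration.integrable_bound[OF Bochner_Integration.integrable_add[OF u(2) A(2)]] AE_I2)
    fix i \<omega>
    have "2 * (\<bar>u \<omega> $ i\<bar> * \<bar>A \<omega> $ i $ j\<bar>) \<le> 2 * (norm (u \<omega>) * norm (A \<omega>))"
      by (intro mult_left_mono mult_mono nth_norm component_le_norm_cart) auto
    also have "\<dots> \<le> (norm (u \<omega>))\<^sup>2 + (norm (A \<omega>))\<^sup>2"
      using sum_squares_bound[of "norm (u \<omega>)" "norm (A \<omega>)"] by simp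
    finally show "norm (2 * u \<omega> $ i * A \<omega> $ i $ j) \<le> norm ((norm (u \<omega>))\<^sup>2 + (norm (A \<omega>))\<^sup>2)"
      by (simp add: abs_mult)
  qed measurable
  have q: "q \<omega> = (\<Sum>j\<in>UNIV. \<Sum>l\<in>UNIV. c j l \<omega> * (D \<omega> $ j * D \<omega> $ l - (if j = l then \<sigma>\<^sup>2 else 0)))
      + (\<Sum>j\<in>UNIV. b j \<omega> * D \<omega> $ j)" for \<omega>
    unfolding q_def c_def b_def by (rule norm_mult_vec_square)
  \<comment> \<open>The indicator of \<open>S\<close> is absorbed into the coefficients, which stay
    \<open>G\<close>-measurable. The choice \<open>S = space M\<close> then gives integrability of
    \<open>q\<close> itself.\<close>
  have main: "integrable M (\<lambda>\<omega>. indicator S \<omega> * q \<omega>) \<and> (\<integral>\<omega>. indicator S \<omega> * q \<omega> \<partial>M) = 0" if S: "S \<in> sets G" for S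
  proof -
    have SM: "S \<in> sets M" using S sub by (auto simp: subalgebra_def)
    have 1: "integrable M (\<lambda>\<omega>. (indicator S \<omega> * c j l \<omega>) * (D \<omega> $ j * D \<omega> $ l - (if j = l then \<sigma>\<^sup>2 else 0)))"
      "(\<integral>\<omega>. (indicator S \<omega> * c j l \<omega>) * (D \<omega> $ j * D \<omega> $ l - (if j = l then \<sigma>\<^sup>2 else 0)) \<partial>M) = 0" for j l
    proof -
      have *: "(\<lambda>\<omega>. indicator S \<omega> * c j l \<omega>) \<in> borel_measurable G"
        using cG[of j l] S by measurable
      have **: "integrable M (\<lambda>\<omega>. indicator S \<omega> * c j l \<omega>)"
        using integrable_mult_indicator[OF SM cI[of j l]] by simp
      note indep_mult_centred[OF sub ind D * **, of "\<lambda>x. x $ j * x $ l - (if j = l then \<sigma>\<^sup>2 else 0)"]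
      with \<phi>[of j l] show "integrable M (\<lambda>\<omega>. (indicator S \<omega> * c j l \<omega>) * (D \<omega> $ j * D \<omega> $ l - (if j = l then \<sigma>\<^sup>2 else 0)))"
        "(\<integral>\<omega>. (indicator S \<omega> * c j l \<omega>) * (D \<omega> $ j * D \<omega> $ l - (if j = l then \<sigma>\<^sup>2 else 0)) \<partial>M) = 0"
        by auto
    qed
    have 2: "integrable M (\<lambda>\<omega>. (indicator S \<omega> * b j \<omega>) * D \<omega> $ j)"
      "(\<integral>\<omega>. (indicator S \<omega> * b j \<omega>) * D \<omega> $ j \<partial>M) = 0" for j
    proof -
      have *: "(\<lambda>\<omega>. indicator S \<omega> * b j \<omega>) \<in> borel_measurable G"
        using bG[of j] S by measurable
      have **: "integrable M (\<lambda>\<omega>. indicator S \<omega> * b j \<omega>)"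
        using integrable_mult_indicator[OF SM bI[of j]] by simp
      show "integrable M (\<lambda>\<omega>. (indicator S \<omega> * b j \<omega>) * D \<omega> $ j)"
        "(\<integral>\<omega>. (indicator S \<omega> * b j \<omega>) * D \<omega> $ j \<partial>M) = 0"
        using indep_mult_centred[OF sub ind D * **, of "\<lambda>x. x $ j"] comp(1,2)[of j] by auto
    qed
    have eq: "indicator S \<omega> * q \<omega> = (\<Sum>j\<in>UNIV. \<Sum>l\<in>UNIV. (indicator S \<omega> * c j l \<omega>) * (D \<omega> $ j * D \<omega> $ l - (if j = l then \<sigma>\<^sup>2 else 0)))
      + (\<Sum>j\<in>UNIV. (indicator S \<omega> * b j \<omega>) * D \<omega> $ j)" for \<omega>
      unfolding q by (simp add: distrib_left sum_distrib_left mult.assoc)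
    show ?thesis unfolding eq using 1 2
      by (simp add: Bochner_Integration.integral_sum Bochner_Integration.integral_add Bochner_Integration.integrable_sum)
  qed
  show "integrable M q"
  proof -
    have "space M \<in> sets G" using sub sets.top[of G] by (simp add: subalgebra_def)
    from main[OF this] have "integrable M (\<lambda>\<omega>. indicator (space M) \<omega> * q \<omega>)" by simp
    then show ?thesis by (rule Bochner_Integration.integrable_cong[THEN iffD1, rotated 2]) auto
  qed
  show "S \<in> sets G \<Longrightarrow> (\<integral>\<omega>. indicator S \<omega> * q \<omega> \<partial>M) = 0" using main by blast
qed

subsection \<open>Moments and adaptedness of the scheme\<close>

lemma segment_space_continuous:
  assumes "\<phi> \<in> mspace (segment_space \<tau>)"
  shows "continuous_on {-\<tau>..0} \<phi>"
  using assms by (auto simp: segment_space_def)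

lemma space_segment_borel: "space (segment_borel \<tau>) = mspace (segment_space \<tau>)"
  unfolding segment_borel_def by (rule space_measure_of_conv)

text \<open>Evaluation at \<open>\<theta>\<close> is 1-Lipschitz for the uniform metric, so
  preimages of open sets are open and belong to the generators of \<open>segment_borel\<close>. This
  turns measurability of the random segment \<open>\<xi>\<close> into measurability of its grid
  values.\<close>

lemma measurable_segment_eval:
  assumes \<theta>: "\<theta> \<in> {-\<tau>..0}"
  shows "(\<lambda>\<phi>. \<phi> \<theta> :: real^'n) \<in> borel_measurable (segment_borel \<tau>)"
proof (rule borel_measurableI)
  fix S :: "(real^'n) set" assume S: "open S"
  let ?m = "segment_space \<tau> :: (real \<Rightarrow> real^'n) metric"
  interpret m: Metric_space "mspace ?m" "mdist ?m" by (rule Metric_space_mspace_mdist)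
  have "openin (mtopology_of ?m) {\<phi> \<in> mspace ?m. \<phi> \<theta> \<in> S}"
    unfolding mtopology_of_def m.openin_mtopology
  proof (intro conjI allI impI)
    fix \<phi> assume "\<phi> \<in> {\<phi> \<in> mspace ?m. \<phi> \<theta> \<in> S}"
    then have \<phi>: "\<phi> \<in> mspace ?m" "\<phi> \<theta> \<in> S" by auto
    obtain r where r: "r > 0" "ball (\<phi> \<theta>) r \<subseteq> S" using S \<phi>(2) by (meson openE)
    have "m.mball \<phi> r \<subseteq> {\<phi> \<in> mspace ?m. \<phi> \<theta> \<in> S}"
    proof
      fix \<psi> assume \<psi>: "\<psi> \<in> m.mball \<phi> r"
      have \<phi>\<psi>: "\<phi> \<in> mspace ?m" "\<psi> \<in> mspace ?m" "mdist ?m \<phi> \<psi> < r"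
        using \<phi>(1) \<psi> by auto
      have X: "compactin (top_of_set {-\<tau>..0}) (topspace (top_of_set {-\<tau>..0}))"
        "\<theta> \<in> topspace (top_of_set {-\<tau>..0})"
        using \<theta> by (simp_all add: compactin_subtopology)
      have "mdist euclidean_metric (\<phi> \<theta>) (\<psi> \<theta>) < r"
        using cfunspace_mdist_lt[OF X(1) \<phi>\<psi>[unfolded segment_space_def] X(2)] .
      then show "\<psi> \<in> {\<phi> \<in> mspace ?m. \<phi> \<theta> \<in> S}" using \<psi> r by auto
    qed
    then show "\<exists>r>0. m.mball \<phi> r \<subseteq> {\<phi> \<in> mspace ?m. \<phi> \<theta> \<in> S}" using r(1) by blast
  qed auto
  moreover have "(\<lambda>\<phi>. \<phi> \<theta>) -` S \<inter> space (segment_borel \<tau>) = {\<phi> \<in> mspace ?m. \<phi> \<theta> \<in> S}"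
    by (auto simp: space_segment_borel)
  moreover have "{U. openin (mtopology_of ?m) U} \<subseteq> Pow (mspace ?m)"
    using openin_subset[of "mtopology_of ?m"] by (auto simp: mtopology_of_def)
  ultimately show "(\<lambda>\<phi>. \<phi> \<theta>) -` S \<inter> space (segment_borel \<tau>) \<in> sets (segment_borel \<tau>)"
    by (auto simp: segment_borel_def)
qed

text \<open>Continuity on a compact interval bounds the range; a real \<open>SUP\<close> over an
  unbounded set would give no upper bound.\<close>

lemma norm_le_segment_norm:
  fixes \<phi> :: "real \<Rightarrow> real^'n"
  assumes \<phi>: "\<phi> \<in> mspace (segment_space \<tau>)" and \<theta>: "\<theta> \<in> {-\<tau>..0}"
  shows "norm (\<phi> \<theta>) \<le> segment_norm \<tau> \<phi>"
proof -
  have "compact ((\<lambda>\<theta>. norm (\<phi> \<theta>)) ` {-\<tau>..0})"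
    using segment_space_continuous[OF \<phi>] by (intro compact_continuous_image continuous_intros) auto
  then have "bdd_above ((\<lambda>\<theta>. norm (\<phi> \<theta>)) ` {-\<tau>..0})"
    by (intro bounded_imp_bdd_above compact_imp_bounded)
  then show ?thesis unfolding segment_norm_def using \<theta> by (intro cSUP_upper)
qed

lemma growth_square:
  fixes x y z :: real
  assumes "0 \<le> x" "0 \<le> y" "0 \<le> z" "z \<le> c * (x + y)"
  shows "z\<^sup>2 \<le> 2 * c\<^sup>2 * (x\<^sup>2 + y\<^sup>2)"
proof -
  have "z\<^sup>2 \<le> (c * (x + y))\<^sup>2" using assms by (intro power_mono) auto
  also have "\<dots> = c\<^sup>2 * (x + y)\<^sup>2" by (simp add: power_mult_distrib)
  also have "\<dots> \<le> c\<^sup>2 * (2 * (x\<^sup>2 + y\<^sup>2))"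
    using sum_squares_bound[of x y] by (intro mult_left_mono) (auto simp: power2_sum)
  finally show ?thesis by (simp add: algebra_simps)
qed

text \<open>One step size is fixed. The numbers \<open>l k\<close> are growth constants of the
  truncated coefficients at the grid times and may vary with \<open>k\<close> without a common
  bound: they serve to keep second moments finite at each step. Dissipativity enters later, as the
  assumption \<open>energy\<close> of \<open>polynomial_decay\<close>.\<close>

locale mtem_scheme = prob_space M for M :: "'a measure" +
  fixes F :: "real \<Rightarrow> 'a measure" and B :: "real \<Rightarrow> 'a \<Rightarrow> real^'d::finite"
    and f :: "real^'n::finite \<Rightarrow> real^'n \<Rightarrow> real \<Rightarrow> real^'n"
    and g :: "real^'n \<Rightarrow> real^'n \<Rightarrow> real \<Rightarrow> real^'d^'n"
    and \<delta> h :: "real \<Rightarrow> real" and \<xi> :: "'a \<Rightarrow> real \<Rightarrow> real^'n"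
    and \<tau> \<Delta> :: real and m :: nat and l :: "nat \<Rightarrow> real"
  assumes usual: "usual_conditions M F" and brownian: "brownian_motion M F B"
    and initial: "bounded_initial M F \<tau> \<xi>"
    and step_pos: "0 < \<Delta>" and tau_eq: "\<tau> = real m * \<Delta>"
    and f_meas: "(\<lambda>(x, y, t). f x y t) \<in> borel_measurable (restrict_space borel (UNIV \<times> UNIV \<times> {0..}))"
    and g_meas: "(\<lambda>(x, y, t). g x y t) \<in> borel_measurable (restrict_space borel (UNIV \<times> UNIV \<times> {0..}))"
    and f_growth: "\<And>k x y. norm (truncated h \<Delta> f x y (real k * \<Delta>)) \<le> l k * (norm x + norm y)"
    and g_growth: "\<And>k x y. norm (truncated h \<Delta> g x y (real k * \<Delta>)) \<le> l k * (norm x + norm y)"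
    and delay: "\<And>k. - int m \<le> int k - int (nat \<lfloor>\<delta> (real k * \<Delta>) / \<Delta>\<rfloor>)"
begin

definition idx :: "nat \<Rightarrow> int" where "idx k = int k - int (nat \<lfloor>\<delta> (real k * \<Delta>) / \<Delta>\<rfloor>)"

definition G :: "nat \<Rightarrow> 'a measure" where "G k = F (real k * \<Delta>)"

definition X :: "int \<Rightarrow> 'a \<Rightarrow> real^'n" where "X = mtem f g \<delta> h \<xi> B \<Delta>"

definition drift :: "nat \<Rightarrow> 'a \<Rightarrow> real^'n" where
  "drift k \<omega> = truncated h \<Delta> f (X (int k) \<omega>) (X (idx k) \<omega>) (real k * \<Delta>)"

definition diffusion :: "nat \<Rightarrow> 'a \<Rightarrow> real^'d^'n" where
  "diffusion k \<omega> = truncated h \<Delta> g (X (int k) \<omega>) (X (idx k) \<omega>) (real k * \<Delta>)"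

definition dB :: "nat \<Rightarrow> 'a \<Rightarrow> real^'d" where
  "dB k \<omega> = B (real k * \<Delta> + \<Delta>) \<omega> - B (real k * \<Delta>) \<omega>"

text \<open>The part of the new squared norm that has mean 0 given \<open>G k\<close>: the
  subtracted \<open>\<Delta> * (norm (diffusion k \<omega>))\<^sup>2\<close> is the conditional mean
  of the squared diffusion increment.\<close>

definition noise :: "nat \<Rightarrow> 'a \<Rightarrow> real" where
  "noise k \<omega> = (norm (diffusion k \<omega> *v dB k \<omega>))\<^sup>2 - \<Delta> * (norm (diffusion k \<omega>))\<^sup>2
     + 2 * ((X (int k) \<omega> + \<Delta> *\<^sub>R drift k \<omega>) \<bullet> (diffusion k \<omega> *v dB k \<omega>))"

lemma idx_bounds: "- int m \<le> idx k" "idx k \<le> int k"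
  using delay[of k] by (auto simp: idx_def)

lemma X_Suc: "X (int k + 1) \<omega> = X (int k) \<omega> + \<Delta> *\<^sub>R drift k \<omega> + diffusion k \<omega> *v dB k \<omega>"
  unfolding X_def drift_def diffusion_def dB_def idx_def
  by (subst mtem.simps) (simp add: Let_def)

text \<open>The conditional mean inside \<open>noise\<close> is added back, so that drift and
  diffusion appear in exactly the combination bounded by (iii), with the squared drift as the only
  discretisation error.\<close>

lemma norm_X_Suc_square:
  "(norm (X (int k + 1) \<omega>))\<^sup>2 = (norm (X (int k) \<omega>))\<^sup>2
     + \<Delta> * (2 * (X (int k) \<omega> \<bullet> drift k \<omega>) + (norm (diffusion k \<omega>))\<^sup>2)
     + \<Delta>\<^sup>2 * (norm (drift k \<omega>))\<^sup>2 + noise k \<omega>"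
proof -
  have eq: "(norm (x + a + b))\<^sup>2 = (norm x)\<^sup>2 + 2 * (x \<bullet> a) + (norm a)\<^sup>2 + (norm b)\<^sup>2 + 2 * ((x + a) \<bullet> b)"
    for x a b :: "real^'n"
    using dot_norm[of "x + a" b] dot_norm[of x a] by (simp only: field_simps)
  have "(norm (X (int k + 1) \<omega>))\<^sup>2 = (norm (X (int k) \<omega>))\<^sup>2 + 2 * (\<Delta> * (X (int k) \<omega> \<bullet> drift k \<omega>))
     + \<Delta>\<^sup>2 * (norm (drift k \<omega>))\<^sup>2 + (norm (diffusion k \<omega> *v dB k \<omega>))\<^sup>2
     + 2 * ((X (int k) \<omega> + \<Delta> *\<^sub>R drift k \<omega>) \<bullet> (diffusion k \<omega> *v dB k \<omega>))"
    unfolding X_Suc eq by (simp only: inner_scaleR_right norm_scaleR power_mult_distrib power2_abs)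
  then show ?thesis unfolding noise_def by (simp only: distrib_left mult.left_commute[of \<Delta> 2])
qed

lemma X_initial: "i \<le> 0 \<Longrightarrow> X i \<omega> = \<xi> \<omega> (real_of_int i * \<Delta>)"
  unfolding X_def by (subst mtem.simps) simp

section \<open>Filtration and adaptedness\<close>

lemma subalgebra_G: "subalgebra M (G k)"
  using usual step_pos by (simp add: usual_conditions_def G_def)

lemma G_mono: "sets (G k) \<subseteq> sets (G (Suc k))"
proof -
  interpret filtration "space M" "\<lambda>t. F (max 0 t)" using usual by (simp add: usual_conditions_def)
  show ?thesis using sets_F_mono[of "real k * \<Delta>" "real (Suc k) * \<Delta>"] step_pos
    by (simp add: G_def)
qed

lemma measurable_G_mono: "j \<le> k \<Longrightarrow> Z \<in> borel_measurable (G j) \<Longrightarrow> Z \<in> borel_measurable (G k)"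
proof -
  assume "j \<le> k" and Z: "Z \<in> borel_measurable (G j)"
  then have "sets (G j) \<subseteq> sets (G k)" using lift_Suc_mono_le[of "\<lambda>k. sets (G k)"] G_mono by blast
  then have "subalgebra (G k) (G j)" using subalgebra_G by (simp add: subalgebra_def)
  from measurable_from_subalg[OF this Z] show ?thesis .
qed

lemma initial_index_in_segment:
  assumes "- int m \<le> i" "i \<le> 0"
  shows "real_of_int i * \<Delta> \<in> {-\<tau>..0}"
proof -
  have "- real m * \<Delta> \<le> real_of_int i * \<Delta>" using assms step_pos by (intro mult_right_mono) auto
  then show ?thesis using assms step_pos by (auto simp: tau_eq mult_nonpos_nonneg)
qed

lemma initial_in_segment_space: "\<omega> \<in> space M \<Longrightarrow> \<xi> \<omega> \<in> mspace (segment_space \<tau>)"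
proof -
  assume \<omega>: "\<omega> \<in> space M"
  have \<xi>: "\<xi> \<in> F 0 \<rightarrow>\<^sub>M segment_borel \<tau>" using initial by (simp add: bounded_initial_def)
  have "space (F 0) = space M" using subalgebra_G[of 0] by (simp add: subalgebra_def G_def)
  with \<omega> have "\<omega> \<in> space (F 0)" by simp
  from measurable_space[OF \<xi> this] show ?thesis by (simp only: space_segment_borel)
qed

lemma adapted_initial:
  assumes "- int m \<le> i" "i \<le> 0"
  shows "X i \<in> borel_measurable (G 0)"
proof -
  have "(\<lambda>\<omega>. \<xi> \<omega> (real_of_int i * \<Delta>)) \<in> borel_measurable (F 0)"
    using initial unfolding bounded_initial_def
    by (elim conjE) (rule measurable_compose[OF _ measurable_segment_eval[OF initial_index_in_segment[OF assms]]])
  moreover have "X i = (\<lambda>\<omega>. \<xi> \<omega> (real_of_int i * \<Delta>))" using X_initial[OF assms(2)] by auto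
  ultimately show ?thesis by (simp add: G_def)
qed

lemma dB_adapted: "dB k \<in> borel_measurable (G (Suc k))"
proof -
  have B: "0 \<le> t \<Longrightarrow> B t \<in> borel_measurable (F t)" for t
    using brownian by (simp add: brownian_motion_def)
  have "B (real (Suc k) * \<Delta>) \<in> borel_measurable (G (Suc k))" "B (real k * \<Delta>) \<in> borel_measurable (G (Suc k))"
    using B[of "real (Suc k) * \<Delta>"] B[of "real k * \<Delta>"] measurable_G_mono[of k "Suc k"] step_pos
    by (auto simp: G_def)
  then have "(\<lambda>\<omega>. B (real (Suc k) * \<Delta>) \<omega> - B (real k * \<Delta>) \<omega>) \<in> borel_measurable (G (Suc k))"
    by (rule borel_measurable_diff)
  moreover have "dB k = (\<lambda>\<omega>. B (real (Suc k) * \<Delta>) \<omega> - B (real k * \<Delta>) \<omega>)"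
    by (auto simp: dB_def algebra_simps)
  ultimately show ?thesis by simp
qed

lemma mult_vec_measurable:
  fixes A :: "'a \<Rightarrow> real^'d^'n" and D :: "'a \<Rightarrow> real^'d"
  assumes "A \<in> borel_measurable N" "D \<in> borel_measurable N"
  shows "(\<lambda>\<omega>. A \<omega> *v D \<omega>) \<in> borel_measurable N"
proof -
  have "continuous_on UNIV (\<lambda>p. fst p *v snd p :: real^'n)"
    unfolding matrix_vector_mult_def by (intro continuous_intros)
  from borel_measurable_continuous_Pair[OF assms this] show ?thesis .
qed

lemma coefficients_measurable:
  assumes X: "X (int k) \<in> borel_measurable (G k)" "X (idx k) \<in> borel_measurable (G k)"
  shows "drift k \<in> borel_measurable (G k)" "diffusion k \<in> borel_measurable (G k)"
    and "(\<lambda>\<omega>. diffusion k \<omega> *v dB k \<omega>) \<in> borel_measurable (G (Suc k))"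
proof -
  show "drift k \<in> borel_measurable (G k)" and diffusion: "diffusion k \<in> borel_measurable (G k)"
    using measurable_truncated[OF f_meas _ X, of "real k * \<Delta>"]
      measurable_truncated[OF g_meas _ X, of "real k * \<Delta>"] step_pos
    unfolding drift_def[abs_def] diffusion_def[abs_def] by auto
  show "(\<lambda>\<omega>. diffusion k \<omega> *v dB k \<omega>) \<in> borel_measurable (G (Suc k))"
    by (rule mult_vec_measurable[OF measurable_G_mono[OF _ diffusion] dB_adapted]) simp
qed

text \<open>All indices up to \<open>k\<close> are treated at once, since the step to
  \<open>Suc k\<close> reads the delayed value \<open>X (idx k)\<close> as well as
  \<open>X (int k)\<close>.\<close>

lemma X_adapted: "- int m \<le> i \<Longrightarrow> i \<le> int k \<Longrightarrow> X i \<in> borel_measurable (G k)"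
proof (induction k arbitrary: i)
  case 0
  then show ?case by (intro adapted_initial) auto
next
  case (Suc k)
  show ?case
  proof (cases "i \<le> int k")
    case True
    then show ?thesis using Suc measurable_G_mono[of k "Suc k"] by auto
  next
    case False
    then have i: "i = int k + 1" using Suc by auto
    have X: "X (int k) \<in> borel_measurable (G k)" "X (idx k) \<in> borel_measurable (G k)"
      using Suc.IH idx_bounds by auto
    note meas = coefficients_measurable[OF X]
    have [measurable]: "drift k \<in> borel_measurable (G (Suc k))" "X (int k) \<in> borel_measurable (G (Suc k))"
      using X(1) meas(1) by (auto intro: measurable_G_mono[of k "Suc k"])
    note meas(3) [measurable]
    have "(\<lambda>\<omega>. X (int k) \<omega> + \<Delta> *\<^sub>R drift k \<omega> + diffusion k \<omega> *v dB k \<omega>) \<in> borel_measurable (G (Suc k))"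
      by measurable
    moreover have "X i = (\<lambda>\<omega>. X (int k) \<omega> + \<Delta> *\<^sub>R drift k \<omega> + diffusion k \<omega> *v dB k \<omega>)"
      unfolding i using X_Suc by auto
    ultimately show ?thesis by simp
  qed
qed

lemma adapted:
  "X (int k) \<in> borel_measurable (G k)" "drift k \<in> borel_measurable (G k)"
  "diffusion k \<in> borel_measurable (G k)" "noise k \<in> borel_measurable (G (Suc k))"
proof -
  show X: "X (int k) \<in> borel_measurable (G k)" by (rule X_adapted) auto
  have "X (idx k) \<in> borel_measurable (G k)" using X_adapted idx_bounds by auto
  note meas = coefficients_measurable[OF X this]
  show "drift k \<in> borel_measurable (G k)" "diffusion k \<in> borel_measurable (G k)" by (rule meas)+
  have [measurable]: "drift k \<in> borel_measurable (G (Suc k))" "diffusion k \<in> borel_measurable (G (Suc k))"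
    "X (int k) \<in> borel_measurable (G (Suc k))"
    using X meas(1,2) by (auto intro: measurable_G_mono[of k "Suc k"])
  note meas(3) [measurable]
  show "noise k \<in> borel_measurable (G (Suc k))" unfolding noise_def[abs_def] by measurable
qed

lemma G_imp_M: "Z \<in> borel_measurable (G k) \<Longrightarrow> Z \<in> borel_measurable M"
  using measurable_from_subalg[OF subalgebra_G] .

text \<open>The uniform norm of the bounded initial segment dominates every grid value. That the
  bound does not depend on \<open>\<omega>\<close> is what later makes the constant added to the
  martingale deterministic.\<close>

lemma initial_bound:
  "\<exists>A\<ge>0. \<forall>\<omega>\<in>space M. \<forall>i. - int m \<le> i \<longrightarrow> i \<le> 0 \<longrightarrow> (norm (X i \<omega>))\<^sup>2 \<le> A"
proof -
  obtain b where b: "\<And>\<omega>. \<omega> \<in> space M \<Longrightarrow> \<bar>segment_norm \<tau> (\<xi> \<omega>)\<bar> \<le> b"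
    using initial by (auto simp: bounded_initial_def bounded_iff)
  show ?thesis
  proof (intro exI[of _ "b\<^sup>2"] conjI ballI allI impI)
    fix i \<omega> assume \<omega>: "\<omega> \<in> space M" and i: "- int m \<le> i" "i \<le> 0"
    have "norm (X i \<omega>) \<le> segment_norm \<tau> (\<xi> \<omega>)"
      unfolding X_initial[OF i(2)]
      by (rule norm_le_segment_norm[OF initial_in_segment_space[OF \<omega>] initial_index_in_segment[OF i]])
    then have "norm (X i \<omega>) \<le> b" using b[OF \<omega>] by linarith
    then show "(norm (X i \<omega>))\<^sup>2 \<le> b\<^sup>2" by (intro power_mono) auto
  qed simp
qed

section \<open>Second moments and centred noise\<close>

lemma drift_square: "(norm (drift k \<omega>))\<^sup>2 \<le> 2 * (l k)\<^sup>2 * ((norm (X (int k) \<omega>))\<^sup>2 + (norm (X (idx k) \<omega>))\<^sup>2)"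
  unfolding drift_def by (intro growth_square f_growth) auto

lemma diffusion_square: "(norm (diffusion k \<omega>))\<^sup>2 \<le> 2 * (l k)\<^sup>2 * ((norm (X (int k) \<omega>))\<^sup>2 + (norm (X (idx k) \<omega>))\<^sup>2)"
  unfolding diffusion_def by (intro growth_square g_growth) auto

text \<open>Kept conditional on two second moments because the induction for
  \<open>square_integrable\<close> uses it; \<open>noise_centred\<close> then discharges them. The
  noise is the form of \<open>gaussian_quadratic_centred\<close> with \<open>u\<close> the Euler
  step without its diffusion part and standard deviation \<open>sqrt \<Delta>\<close>.\<close>

lemma noise_centred_aux:
  assumes x: "integrable M (\<lambda>\<omega>. (norm (X (int k) \<omega>))\<^sup>2)" and y: "integrable M (\<lambda>\<omega>. (norm (X (idx k) \<omega>))\<^sup>2)"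
  shows "integrable M (\<lambda>\<omega>. (norm (drift k \<omega>))\<^sup>2)" "integrable M (\<lambda>\<omega>. (norm (diffusion k \<omega>))\<^sup>2)"
    "integrable M (noise k)" "S \<in> sets (G k) \<Longrightarrow> (\<integral>\<omega>. indicator S \<omega> * noise k \<omega> \<partial>M) = 0"
proof -
  have meas [measurable]: "drift k \<in> borel_measurable M" "diffusion k \<in> borel_measurable M"
     "X (int k) \<in> borel_measurable M" "dB k \<in> borel_measurable M"
    using adapted(2,3)[of k] adapted(1)[of k] dB_adapted[of k] G_imp_M by auto
  have dom: "integrable M (\<lambda>\<omega>. 2 * (l k)\<^sup>2 * ((norm (X (int k) \<omega>))\<^sup>2 + (norm (X (idx k) \<omega>))\<^sup>2))"
    using x y by auto
  show dr: "integrable M (\<lambda>\<omega>. (norm (drift k \<omega>))\<^sup>2)"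
    by (rule Bochner_Integration.integrable_bound[OF dom]) (use drift_square in auto)
  show di: "integrable M (\<lambda>\<omega>. (norm (diffusion k \<omega>))\<^sup>2)"
    by (rule Bochner_Integration.integrable_bound[OF dom]) (use diffusion_square in auto)
  define u where "u \<omega> = X (int k) \<omega> + \<Delta> *\<^sub>R drift k \<omega>" for \<omega>
  have X: "X (int k) \<in> borel_measurable (G k)" by (rule adapted(1))
  have uG: "u \<in> borel_measurable (G k)"
    unfolding u_def[abs_def] using X adapted(2)[of k] by measurable
  have [measurable]: "u \<in> borel_measurable M" by (rule G_imp_M[OF uG])
  have "integrable M (\<lambda>\<omega>. 2 * ((norm (X (int k) \<omega>))\<^sup>2 + \<Delta>\<^sup>2 * (norm (drift k \<omega>))\<^sup>2))" using x dr by auto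
  then have uI: "integrable M (\<lambda>\<omega>. (norm (u \<omega>))\<^sup>2)"
  proof (rule Bochner_Integration.integrable_bound)
    have "(norm (u \<omega>))\<^sup>2 \<le> 2 * ((norm (X (int k) \<omega>))\<^sup>2 + \<Delta>\<^sup>2 * (norm (drift k \<omega>))\<^sup>2)" for \<omega>
      using growth_square[of "norm (X (int k) \<omega>)" "\<Delta> * norm (drift k \<omega>)" "norm (u \<omega>)" 1]
        norm_triangle_ineq[of "X (int k) \<omega>" "\<Delta> *\<^sub>R drift k \<omega>"] step_pos
      by (simp add: u_def power_mult_distrib)
    then show "AE \<omega> in M. norm ((norm (u \<omega>))\<^sup>2) \<le> norm (2 * ((norm (X (int k) \<omega>))\<^sup>2 + \<Delta>\<^sup>2 * (norm (drift k \<omega>))\<^sup>2))"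
      by (auto intro: order_trans[OF _ abs_ge_self])
  qed measurable
  have incr: "indep_set (sets (G k)) (sets (vimage_algebra (space M) (dB k) borel))"
    "indep_vars (\<lambda>_. borel) (\<lambda>i \<omega>. dB k \<omega> $ i) UNIV"
    "\<And>i. distributed M lborel (\<lambda>\<omega>. dB k \<omega> $ i) (\<lambda>x. ennreal (normal_density 0 (sqrt \<Delta>) x))"
  proof -
    have "0 \<le> real k * \<Delta> \<and> real k * \<Delta> < real k * \<Delta> + \<Delta>" using step_pos by auto
    with brownian have "indep_set (sets (F (real k * \<Delta>))) (sets (vimage_algebra (space M)
          (\<lambda>\<omega>. B (real k * \<Delta> + \<Delta>) \<omega> - B (real k * \<Delta>) \<omega>) borel)) \<and>
        indep_vars (\<lambda>_. borel) (\<lambda>i \<omega>. (B (real k * \<Delta> + \<Delta>) \<omega> - B (real k * \<Delta>) \<omega>) $ i) UNIV \<and>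
        (\<forall>i. distributed M lborel (\<lambda>\<omega>. (B (real k * \<Delta> + \<Delta>) \<omega> - B (real k * \<Delta>) \<omega>) $ i)
          (\<lambda>x. ennreal (normal_density 0 (sqrt (real k * \<Delta> + \<Delta> - real k * \<Delta>)) x)))"
      unfolding brownian_motion_def by blast
    then show "indep_set (sets (G k)) (sets (vimage_algebra (space M) (dB k) borel))"
      "indep_vars (\<lambda>_. borel) (\<lambda>i \<omega>. dB k \<omega> $ i) UNIV"
      "\<And>i. distributed M lborel (\<lambda>\<omega>. dB k \<omega> $ i) (\<lambda>x. ennreal (normal_density 0 (sqrt \<Delta>) x))"
      by (simp_all add: G_def dB_def[abs_def])
  qed
  note gq = gaussian_quadratic_centred[OF subalgebra_G incr(1,2) _ incr(3) meas(4) uG uI adapted(3) di]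
  have "noise k = (\<lambda>\<omega>. (norm (diffusion k \<omega> *v dB k \<omega>))\<^sup>2 - (norm (diffusion k \<omega>))\<^sup>2 * (sqrt \<Delta>)\<^sup>2
     + 2 * (u \<omega> \<bullet> (diffusion k \<omega> *v dB k \<omega>)))"
    using step_pos by (auto simp: noise_def u_def mult.commute)
  with gq step_pos show "integrable M (noise k)" "S \<in> sets (G k) \<Longrightarrow> (\<integral>\<omega>. indicator S \<omega> * noise k \<omega> \<partial>M) = 0"
    by simp_all
qed

lemma square_integrable: "- int m \<le> i \<Longrightarrow> i \<le> int k \<Longrightarrow> integrable M (\<lambda>\<omega>. (norm (X i \<omega>))\<^sup>2)"
proof (induction k arbitrary: i)
  case 0
  obtain A where A: "0 \<le> A"
    "\<And>i \<omega>. \<omega> \<in> space M \<Longrightarrow> - int m \<le> i \<Longrightarrow> i \<le> 0 \<Longrightarrow> (norm (X i \<omega>))\<^sup>2 \<le> A"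
    using initial_bound by blast
  have [measurable]: "X i \<in> borel_measurable M"
    using 0 adapted_initial G_imp_M by auto
  show ?case
    by (rule Bochner_Integration.integrable_bound[of _ "\<lambda>_. A"]) (use 0 A in auto)
next
  case (Suc k)
  show ?case
  proof (cases "i \<le> int k")
    case False
    then have i: "i = int k + 1" using Suc by auto
    have x: "integrable M (\<lambda>\<omega>. (norm (X (int k) \<omega>))\<^sup>2)" and y: "integrable M (\<lambda>\<omega>. (norm (X (idx k) \<omega>))\<^sup>2)"
      using Suc.IH idx_bounds by auto
    note n = noise_centred_aux[OF x y]
    have [measurable]: "drift k \<in> borel_measurable M" "X (int k) \<in> borel_measurable M"
      using adapted(2)[of k] adapted(1)[of k] G_imp_M by auto
    have "integrable M (\<lambda>\<omega>. X (int k) \<omega> \<bullet> drift k \<omega>)"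
    proof (rule Bochner_Integration.integrable_bound[OF Bochner_Integration.integrable_add[OF x n(1)]])
      have "\<bar>X (int k) \<omega> \<bullet> drift k \<omega>\<bar> \<le> (norm (X (int k) \<omega>))\<^sup>2 + (norm (drift k \<omega>))\<^sup>2" for \<omega>
      proof -
        have "\<bar>X (int k) \<omega> \<bullet> drift k \<omega>\<bar> \<le> norm (X (int k) \<omega>) * norm (drift k \<omega>)"
          by (rule Cauchy_Schwarz_ineq2)
        moreover have "2 * (norm (X (int k) \<omega>) * norm (drift k \<omega>)) \<le> (norm (X (int k) \<omega>))\<^sup>2 + (norm (drift k \<omega>))\<^sup>2"
          using sum_squares_bound[of "norm (X (int k) \<omega>)" "norm (drift k \<omega>)"] by (simp add: mult.assoc)
        moreover have "0 \<le> norm (X (int k) \<omega>) * norm (drift k \<omega>)" by simp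
        ultimately show ?thesis by linarith
      qed
      then show "AE \<omega> in M. norm (X (int k) \<omega> \<bullet> drift k \<omega>) \<le> norm ((norm (X (int k) \<omega>))\<^sup>2 + (norm (drift k \<omega>))\<^sup>2)"
        by auto
    qed measurable
    then show ?thesis
      unfolding i norm_X_Suc_square using x n(1,2,3) by auto
  qed (use Suc in auto)
qed

lemma noise_centred:
  shows "integrable M (noise k)" and "S \<in> sets (G k) \<Longrightarrow> (\<integral>\<omega>. indicator S \<omega> * noise k \<omega> \<partial>M) = 0"
  using noise_centred_aux[of k] square_integrable[of "int k" k] square_integrable[of "idx k" k]
    idx_bounds[of k] by auto

text \<open>The process \<open>Y\<close> has no sign by construction: it is nonnegative because it
  dominates the weighted squared norm, and this admits the maximal inequality. Passing from the
  squared norm to the norm halves the exponent in the almost sure rate.\<close>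

lemma polynomial_decay:
  assumes \<Delta>: "\<Delta> \<le> 1" and C: "0 < C" "C < 1" "C < p"
    and coeff: "0 \<le> \<alpha>" "0 \<le> \<beta>" "0 \<le> K" "C + \<beta> * (1 + \<Delta>) * real q \<le> \<alpha>"
    and energy: "\<And>k \<omega>. \<Delta> * (2 * (X (int k) \<omega> \<bullet> drift k \<omega>) + (norm (diffusion k \<omega>))\<^sup>2) + \<Delta>\<^sup>2 * (norm (drift k \<omega>))\<^sup>2
        \<le> \<Delta> / (1 + real k * \<Delta>) * (K * (1 + real k * \<Delta>) powr (- p)
            - \<alpha> * (norm (X (int k) \<omega>))\<^sup>2 + \<beta> * (norm (X (idx k) \<omega>))\<^sup>2)"
    and fibre: "\<And>n j. card {k \<in> {..<n}. idx k = j} \<le> q"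
  shows "AE \<omega> in M. path_exponent \<Delta> X \<omega> \<le> ereal (- C / 2)" and "ms_exponent M \<Delta> X \<le> ereal (- C)"
proof -
  obtain A where A: "0 \<le> A"
    "\<And>i \<omega>. \<omega> \<in> space M \<Longrightarrow> - int m \<le> i \<Longrightarrow> i \<le> 0 \<Longrightarrow> (norm (X i \<omega>))\<^sup>2 \<le> A"
    using initial_bound by blast
  define s where "s = (\<Sum>k. (1 + real k * \<Delta>) powr (C - 1 - p))"
  have s: "(\<Sum>k<n. (1 + real k * \<Delta>) powr (C - 1 - p)) \<le> s" for n
    unfolding s_def using C step_pos by (intro sum_le_suminf summable_powr_arith_progression) auto
  have s0: "0 \<le> s" using s[of 0] by simp
  \<comment> \<open>The deterministic part of \<open>weighted_energy_bound\<close>; the extra 1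
    secures \<open>0 < c\<close>, so that its logarithm can be taken.\<close>
  define c where "c = 1 + A + \<beta> * (1 + \<Delta>) * real q * (\<Delta> * real m * A) + 2 * K * \<Delta> * s"
  have c: "0 < c" unfolding c_def using A coeff step_pos s0 by (intro add_pos_nonneg) auto
  define W where "W k = (1 + real k * \<Delta>) powr C" for k :: nat
  have pos: "0 < 1 + real k * \<Delta>" for k using step_pos by (simp add: add_pos_nonneg)
  have W: "0 < W k" for k using pos[of k] by (simp add: W_def)
  define Y where "Y n \<omega> = c + (\<Sum>k<n. W (Suc k) * noise k \<omega>)" for n \<omega>
  have XY: "W n * (norm (X (int n) \<omega>))\<^sup>2 \<le> Y n \<omega>" if \<omega>: "\<omega> \<in> space M" for n \<omega>
  proof -
    have "(1 + real n * \<Delta>) powr C * (norm (X (int n) \<omega>))\<^sup>2 \<le>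
     A + \<beta> * (1 + \<Delta>) * real q * (\<Delta> * real m * A)
       + 2 * K * \<Delta> * (\<Sum>k<n. (1 + real k * \<Delta>) powr (C - 1 - p))
       + (\<Sum>k<n. (1 + (real k + 1) * \<Delta>) powr C * noise k \<omega>)"
    proof (rule weighted_energy_bound[where idx = idx and \<alpha> = \<alpha>])
      fix k
      show "(norm (X (int k + 1) \<omega>))\<^sup>2 \<le> (norm (X (int k) \<omega>))\<^sup>2 + \<Delta> / (1 + real k * \<Delta>) *
         (K * (1 + real k * \<Delta>) powr - p - \<alpha> * (norm (X (int k) \<omega>))\<^sup>2 + \<beta> * (norm (X (idx k) \<omega>))\<^sup>2) + noise k \<omega>"
        unfolding norm_X_Suc_square using energy[of k \<omega>] by linarith
    qed (use assms step_pos idx_bounds A \<omega> in auto)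
    also have "\<dots> \<le> Y n \<omega>"
    proof -
      have "2 * K * \<Delta> * (\<Sum>k<n. (1 + real k * \<Delta>) powr (C - 1 - p)) \<le> 2 * K * \<Delta> * s"
        using s coeff step_pos by (intro mult_left_mono) auto
      then show ?thesis unfolding Y_def c_def W_def by (simp add: add.commute)
    qed
    finally show ?thesis by (simp add: W_def)
  qed
  have Yint: "integrable M (Y n)" for n
    unfolding Y_def[abs_def] using noise_centred(1) by auto
  have Ynn: "0 \<le> Y n \<omega>" if "\<omega> \<in> space M" for n \<omega>
    using XY[OF that, of n] W[of n] by (meson less_imp_le mult_nonneg_nonneg order_trans zero_le_power2)
  have Yad: "Y n \<in> borel_measurable (G n)" for n
  proof -
    have "noise k \<in> borel_measurable (G n)" if "k < n" for k
      using measurable_G_mono[of "Suc k" n] adapted(4)[of k] that by auto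
    then show ?thesis unfolding Y_def[abs_def]
      by (intro borel_measurable_add borel_measurable_sum borel_measurable_times) auto
  qed
  have mart: "(\<integral>\<omega>. indicator S \<omega> * (Y (Suc k) \<omega> - Y k \<omega>) \<partial>M) = 0" if "S \<in> sets (G k)" for S k
  proof -
    have "(\<integral>\<omega>. indicator S \<omega> * (Y (Suc k) \<omega> - Y k \<omega>) \<partial>M) = (\<integral>\<omega>. W (Suc k) * (indicator S \<omega> * noise k \<omega>) \<partial>M)"
      by (intro Bochner_Integration.integral_cong) (auto simp: Y_def)
    then show ?thesis using noise_centred(2)[OF that] by simp
  qed
  have EY: "expectation (Y n) = c" for n
  proof -
    have "expectation (noise k) = 0" for k
    proof -
      have "space M \<in> sets (G k)" using subalgebra_G[of k] sets.top[of "G k"] by (simp add: subalgebra_def)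
      from noise_centred(2)[OF this] show ?thesis
        by (subst (asm) Bochner_Integration.integral_cong[OF refl, of _ _ "noise k"]) auto
    qed
    then show ?thesis unfolding Y_def using noise_centred(1) by (simp add: prob_space)
  qed
  have "ennreal ((norm (X (int n) \<omega>))\<^sup>2) \<le> ennreal (Y n \<omega> / W n)" if "\<omega> \<in> space M" for n \<omega>
    using XY[OF that, of n] W[of n] by (intro ennreal_leI) (simp add: field_simps)
  then have "(\<integral>\<^sup>+\<omega>. ennreal ((norm (X (int n) \<omega>))\<^sup>2) \<partial>M) \<le> (\<integral>\<^sup>+\<omega>. ennreal (Y n \<omega> / W n) \<partial>M)" for n
    by (intro nn_integral_mono) auto
  also have "(\<integral>\<^sup>+\<omega>. ennreal (Y n \<omega> / W n) \<partial>M) = ennreal (c * (1 + real n * \<Delta>) powr (- C))" for n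
    using Yint[of n] Ynn W[of n] EY[of n]
    by (subst nn_integral_eq_integral) (auto simp: W_def powr_minus divide_inverse less_imp_le)
  finally show "ms_exponent M \<Delta> X \<le> ereal (- C)"
    unfolding ms_exponent_def by (rule limsup_elog_le[OF step_pos c])
  have "AE \<omega> in M. bdd_above (range (\<lambda>k. Y k \<omega>))"
    by (rule nonneg_martingale_bdd_above[where G = G, OF subalgebra_G G_mono Yad Yint Ynn mart])
  then show "AE \<omega> in M. path_exponent \<Delta> X \<omega> \<le> ereal (- C / 2)"
  proof (rule AE_mp, intro AE_I2 impI)
    fix \<omega> assume \<omega>: "\<omega> \<in> space M" and "bdd_above (range (\<lambda>k. Y k \<omega>))"
    then obtain b where b: "\<And>k. Y k \<omega> \<le> b" by (auto simp: bdd_above_def)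
    \<comment> \<open>The shift by 1 keeps \<open>d\<close> positive even if \<open>b\<close> is
      0.\<close>
    define d where "d = sqrt (b + 1)"
    have "0 \<le> b" using Ynn[OF \<omega>, of 0] b[of 0] by linarith
    then have d: "0 < d" "d\<^sup>2 = b + 1" by (auto simp: d_def)
    have "norm (X (int n) \<omega>) \<le> d * (1 + real n * \<Delta>) powr (- (C / 2))" for n
    proof (rule power2_le_imp_le)
      have "W n * (norm (X (int n) \<omega>))\<^sup>2 \<le> b + 1" using XY[OF \<omega>, of n] b[of n] by linarith
      then have "(norm (X (int n) \<omega>))\<^sup>2 \<le> (b + 1) * (1 + real n * \<Delta>) powr (- C)"
        using W[of n] by (simp add: W_def powr_minus field_simps)
      also have "\<dots> = (d * (1 + real n * \<Delta>) powr (- (C / 2)))\<^sup>2"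
      proof -
        have "((1 + real n * \<Delta>) powr (- (C / 2)))\<^sup>2 = (1 + real n * \<Delta>) powr (- C)"
          by (simp add: power2_eq_square powr_add[symmetric])
        then show ?thesis by (simp only: power_mult_distrib d(2))
      qed
      finally show "(norm (X (int n) \<omega>))\<^sup>2 \<le> (d * (1 + real n * \<Delta>) powr (- (C / 2)))\<^sup>2" .
    qed (use d in simp)
    then have "path_exponent \<Delta> X \<omega> \<le> ereal (- (C / 2))"
      unfolding path_exponent_def by (intro limsup_elog_le[OF step_pos d(1)] ennreal_leI)
    then show "path_exponent \<Delta> X \<omega> \<le> ereal (- C / 2)" by simp
  qed
qed

end

subsection \<open>Polynomial stability\<close>

text \<open>Relative to the prefactor \<open>\<Delta> / (1 + t)\<close> there are two errors, each
  at most \<open>e\<close> times the sum of squares: the rescaled constant of (iii), through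
  \<open>K / (h \<Delta>)\<^sup>2\<close>, and the squared drift, through
  \<open>2 * ((1 + t) * l\<^sup>2 * \<Delta>)\<close>. Hence the loss \<open>2 * e\<close> in both
  coefficients.\<close>

lemma truncated_energy:
  fixes f :: "real^'n \<Rightarrow> real^'n \<Rightarrow> real \<Rightarrow> real^'n" and g :: "real^'n \<Rightarrow> real^'n \<Rightarrow> real \<Rightarrow> real^'d^'n"
  assumes h: "0 < h \<Delta>" and t: "0 \<le> t" and \<Delta>: "0 < \<Delta>" and K: "0 \<le> K" and p: "0 \<le> p"
    and diss: "\<And>x y. 2 * (x \<bullet> f x y t) + (norm (g x y t))\<^sup>2
        \<le> (K * (1 + t) powr (- p) - a * (norm x)\<^sup>2 + b * (norm y)\<^sup>2) / (1 + t)"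
    and growth: "norm (truncated h \<Delta> f x y t) \<le> l * (norm x + norm y)"
    and small: "K / (h \<Delta>)\<^sup>2 \<le> e" "2 * ((1 + t) * l\<^sup>2 * \<Delta>) \<le> e"
  shows "\<Delta> * (2 * (x \<bullet> truncated h \<Delta> f x y t) + (norm (truncated h \<Delta> g x y t))\<^sup>2)
      + \<Delta>\<^sup>2 * (norm (truncated h \<Delta> f x y t))\<^sup>2
    \<le> \<Delta> / (1 + t) * (K * (1 + t) powr (- p) - (a - 2 * e) * (norm x)\<^sup>2 + (b + 2 * e) * (norm y)\<^sup>2)"
proof -
  define s where "s = (norm x)\<^sup>2 + (norm y)\<^sup>2"
  define P where "P = K * (1 + t) powr (- p)"
  define z where "z = 2 * (x \<bullet> truncated h \<Delta> f x y t) + (norm (truncated h \<Delta> g x y t))\<^sup>2"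
  have s: "0 \<le> s" by (simp add: s_def)
  have t1: "0 < 1 + t" using t by simp
  \<comment> \<open>Dropping the decaying factor here makes the control of the truncation error
    uniform in time.\<close>
  have PK: "P \<le> K"
  proof -
    have "(1 + t) powr (- p) \<le> 1 powr (- p)" using t p by (intro powr_mono2') auto
    then show ?thesis using K mult_left_mono[of "(1 + t) powr (- p)" 1 K] by (simp add: P_def)
  qed
  have "z \<le> P / (1 + t) + P / (1 + t) / (h \<Delta>)\<^sup>2 * s - a / (1 + t) * (norm x)\<^sup>2 + b / (1 + t) * (norm y)\<^sup>2"
    unfolding z_def s_def
  proof (rule truncated_dissipative[where h = h and \<Delta> = \<Delta>, OF h])
    show "0 \<le> P / (1 + t)" using K t by (simp add: P_def)
    fix x y
    show "2 * (x \<bullet> f x y t) + (norm (g x y t))\<^sup>2 \<le> P / (1 + t) - a / (1 + t) * (norm x)\<^sup>2 + b / (1 + t) * (norm y)\<^sup>2"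
      using diss[of x y] by (simp add: P_def add_divide_distrib diff_divide_distrib)
  qed
  then have "(1 + t) * z \<le> (1 + t) * (P / (1 + t) + P / (1 + t) / (h \<Delta>)\<^sup>2 * s - a / (1 + t) * (norm x)\<^sup>2 + b / (1 + t) * (norm y)\<^sup>2)"
    using t1 by (intro mult_left_mono) auto
  also have "\<dots> = P + P / (h \<Delta>)\<^sup>2 * s - a * (norm x)\<^sup>2 + b * (norm y)\<^sup>2"
    using t1 by (simp add: distrib_left right_diff_distrib)
  also have "P / (h \<Delta>)\<^sup>2 * s \<le> e * s"
    using PK small(1) s by (intro mult_right_mono order_trans[OF divide_right_mono small(1)]) auto
  finally have z: "(1 + t) * z \<le> P + e * s - a * (norm x)\<^sup>2 + b * (norm y)\<^sup>2" by simp
  have "(1 + t) * (\<Delta> * (norm (truncated h \<Delta> f x y t))\<^sup>2) \<le> (1 + t) * (\<Delta> * (2 * l\<^sup>2 * s))"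
    unfolding s_def using t1 \<Delta> by (intro mult_left_mono growth_square growth) auto
  also have "\<dots> = 2 * ((1 + t) * l\<^sup>2 * \<Delta>) * s" by simp
  also have "\<dots> \<le> e * s" by (rule mult_right_mono[OF small(2) s])
  finally have "(1 + t) * z + (1 + t) * (\<Delta> * (norm (truncated h \<Delta> f x y t))\<^sup>2)
      \<le> P - (a - 2 * e) * (norm x)\<^sup>2 + (b + 2 * e) * (norm y)\<^sup>2"
    using z by (simp add: s_def algebra_simps)
  then have "\<Delta> / (1 + t) * ((1 + t) * z + (1 + t) * (\<Delta> * (norm (truncated h \<Delta> f x y t))\<^sup>2))
      \<le> \<Delta> / (1 + t) * (P - (a - 2 * e) * (norm x)\<^sup>2 + (b + 2 * e) * (norm y)\<^sup>2)"
    using \<Delta> t1 by (intro mult_left_mono) auto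
  moreover have "\<Delta> / (1 + t) * ((1 + t) * z + (1 + t) * (\<Delta> * (norm (truncated h \<Delta> f x y t))\<^sup>2))
      = \<Delta> * z + \<Delta>\<^sup>2 * (norm (truncated h \<Delta> f x y t))\<^sup>2"
    using t1 by (simp add: field_simps power2_eq_square)
  ultimately show ?thesis by (simp add: z_def P_def)
qed

text \<open>As \<open>\<Delta>\<close> tends to 0, \<open>R = h \<Delta>\<close> tends to infinity,
  and the inverse function evaluated there is \<open>\<Delta>\<close>. The supremum in the limit
  condition then bounds all times \<open>t\<close> at once.\<close>

lemma truncation_threshold:
  fixes h :: "real \<Rightarrow> real" and L :: "real \<Rightarrow> real \<Rightarrow> real"
  assumes h: "filterlim h at_top (at_right 0)" and inj: "inj_on h {0<..\<Delta>\<^sub>0}" and \<Delta>0: "0 < \<Delta>\<^sub>0"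
    and lim: "((\<lambda>R. SUP t\<in>{0..}. ereal ((1 + t) * (L R t)\<^sup>2 * the_inv_into {0<..\<Delta>\<^sub>0} h R)) \<longlongrightarrow> 0) at_top"
    and e: "0 < e" and K: "0 \<le> K"
  shows "\<exists>\<Delta>s>0. \<forall>\<Delta>. 0 < \<Delta> \<longrightarrow> \<Delta> \<le> \<Delta>s \<longrightarrow> \<Delta> \<le> \<Delta>\<^sub>0 \<longrightarrow>
    K / (h \<Delta>)\<^sup>2 \<le> e \<and> (\<forall>t\<ge>0. 2 * ((1 + t) * (L (h \<Delta>) t)\<^sup>2 * \<Delta>) \<le> e)"
proof -
  define S where "S R = (SUP t\<in>{0..}. ereal ((1 + t) * (L R t)\<^sup>2 * the_inv_into {0<..\<Delta>\<^sub>0} h R))" for R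
  have "eventually (\<lambda>R. S R < ereal (e / 2)) at_top"
    using lim e unfolding S_def[symmetric] by (intro order_tendstoD(2)[of S 0]) auto
  then have "eventually (\<lambda>\<Delta>. S (h \<Delta>) < ereal (e / 2)) (at_right 0)"
    using h by (rule eventually_compose_filterlim)
  \<comment> \<open>Once \<open>h \<Delta>\<close> is at least 1 its square dominates it, so the
    lower bound \<open>K / e\<close> on \<open>h \<Delta>\<close> carries over to the
    square.\<close>
  moreover have "eventually (\<lambda>\<Delta>. max 1 (K / e) \<le> h \<Delta>) (at_right 0)"
    using h unfolding filterlim_at_top by blast
  ultimately have "eventually (\<lambda>\<Delta>. S (h \<Delta>) < ereal (e / 2) \<and> max 1 (K / e) \<le> h \<Delta>) (at_right 0)"
    by (rule eventually_conj)
  then obtain b where b: "b > 0"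
    "\<And>\<Delta>. 0 < \<Delta> \<Longrightarrow> \<Delta> < b \<Longrightarrow> S (h \<Delta>) < ereal (e / 2) \<and> max 1 (K / e) \<le> h \<Delta>"
    by (auto simp: eventually_at_right_field)
  show ?thesis
  proof (intro exI[of _ "b / 2"] conjI allI impI)
    fix \<Delta> assume \<Delta>: "0 < \<Delta>" "\<Delta> \<le> b / 2" "\<Delta> \<le> \<Delta>\<^sub>0"
    then have b': "S (h \<Delta>) < ereal (e / 2)" "1 \<le> h \<Delta>" "K / e \<le> h \<Delta>" using b(2)[of \<Delta>] b(1) by auto
    have "h \<Delta> * 1 \<le> h \<Delta> * h \<Delta>" using b'(2) by (intro mult_left_mono) auto
    then have "K / e \<le> (h \<Delta>)\<^sup>2" using b'(3) by (simp add: power2_eq_square)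
    then show "K / (h \<Delta>)\<^sup>2 \<le> e" using e b'(2) by (simp add: field_simps)
    fix t :: real assume "0 \<le> t"
    then have "ereal ((1 + t) * (L (h \<Delta>) t)\<^sup>2 * the_inv_into {0<..\<Delta>\<^sub>0} h (h \<Delta>)) \<le> S (h \<Delta>)"
      unfolding S_def by (intro SUP_upper) auto
    also have "\<dots> \<le> ereal (e / 2)" using b' by simp
    finally show "2 * ((1 + t) * (L (h \<Delta>) t)\<^sup>2 * \<Delta>) \<le> e"
      using \<Delta> the_inv_into_f_f[OF inj, of \<Delta>] by simp
  qed (use b in simp)
qed

theorem theorem1p7:
  fixes M :: "'a measure" and F :: "real \<Rightarrow> 'a measure"
    and B :: "real \<Rightarrow> 'a \<Rightarrow> real^'d::finite"
    and f :: "real^'n::finite \<Rightarrow> real^'n \<Rightarrow> real \<Rightarrow> real^'n"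
    and g :: "real^'n \<Rightarrow> real^'n \<Rightarrow> real \<Rightarrow> real^'d^'n"
    and \<xi> :: "'a \<Rightarrow> real \<Rightarrow> real^'n"
    and \<tau> \<eta> K lam\<^sub>0 lam\<^sub>1 lam\<^sub>2 \<Delta>\<^sub>0 N :: real
    and \<delta> \<delta>' h :: "real \<Rightarrow> real"
    and L :: "real \<Rightarrow> real \<Rightarrow> real"
    and X :: "real \<Rightarrow> int \<Rightarrow> 'a \<Rightarrow> real^'n"
  defines "X \<equiv> mtem f g \<delta> h \<xi> B"
    and "N \<equiv> real_of_int \<lfloor>inverse (1 - \<eta>)\<rfloor>"
  assumes "prob_space M" and "complete_measure M"
    and "usual_conditions M F"
    and "brownian_motion M F B"
    and "0 \<le> \<tau>"
    and "bounded_initial M F \<tau> \<xi>"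
    and "(\<integral>\<^sup>+\<omega>. ennreal ((segment_norm \<tau> (\<xi> \<omega>))\<^sup>2) \<partial>M) < \<infinity>"
    and "\<And>t. 0 \<le> t \<Longrightarrow> 0 \<le> \<delta> t"
    and "\<delta> 0 = \<tau>"
    and "\<And>t. 0 \<le> t \<Longrightarrow> (\<delta> has_real_derivative \<delta>' t) (at t within {0..})"
    and "continuous_on {0..} \<delta>'"
    and "\<not> bounded (\<delta> ` {0..})"
    and "(\<lambda>(x, y, t). f x y t) \<in> borel_measurable (restrict_space borel (UNIV \<times> UNIV \<times> {0..}))"
    and "(\<lambda>(x, y, t). g x y t) \<in> borel_measurable (restrict_space borel (UNIV \<times> UNIV \<times> {0..}))"
    and "\<And>t. 0 \<le> t \<Longrightarrow> f 0 0 t = 0"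
    and "\<And>t. 0 \<le> t \<Longrightarrow> g 0 0 t = 0"
    and "0 < \<Delta>\<^sub>0"
    and "\<And>\<Delta>. \<Delta> \<in> {0<..\<Delta>\<^sub>0} \<Longrightarrow> 0 < h \<Delta>"
    and "antimono_on {0<..\<Delta>\<^sub>0} h" and "inj_on h {0<..\<Delta>\<^sub>0}"
    and "filterlim h at_top (at_right 0)"
    and "eventually (\<lambda>R. R \<in> h ` {0<..\<Delta>\<^sub>0}) at_top"
    \<comment> \<open>(i)\<close>
    and "\<eta> < 1" and "\<And>t. 0 \<le> t \<Longrightarrow> \<delta>' t \<le> \<eta>"
    \<comment> \<open>(ii)\<close>
    and "\<And>R t. 0 < R \<Longrightarrow> 0 \<le> t \<Longrightarrow> 0 < L R t"
    and "\<And>t. 0 \<le> t \<Longrightarrow> mono_on {0<..} (\<lambda>R. L R t)"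
    and "\<And>R t x x' y y'. 0 < R \<Longrightarrow> 0 \<le> t \<Longrightarrow>
           max (max (norm x) (norm x')) (max (norm y) (norm y')) \<le> R \<Longrightarrow>
           max (norm (f x y t - f x' y' t)) (norm (g x y t - g x' y' t))
             \<le> L R t * (norm (x - x') + norm (y - y'))"
    \<comment> \<open>(iii)\<close>
    and "0 < K" and "0 < lam\<^sub>0" and "0 < lam\<^sub>1" and "0 < lam\<^sub>2"
    and "\<And>t x y. 0 \<le> t \<Longrightarrow>
           2 * (x \<bullet> f x y t) + (norm (g x y t))\<^sup>2
             \<le> (K * (1 + t) powr (- lam\<^sub>0) - lam\<^sub>1 * (norm x)\<^sup>2 + lam\<^sub>2 * (norm y)\<^sup>2) / (1 + t)"
    \<comment> \<open>(iv)\<close>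
    and "lam\<^sub>1 - lam\<^sub>2 * (N + 1) > 0"
    \<comment> \<open>(v)\<close>
    and "((\<lambda>R. SUP t\<in>{0..}. ereal ((1 + t) * (L R t)\<^sup>2 * the_inv_into {0<..\<Delta>\<^sub>0} h R))
            \<longlongrightarrow> 0) at_top"
  shows "as_polynomially_stable M (step_sizes \<tau> \<Delta>\<^sub>0) X \<and>
         ms_polynomially_stable M (step_sizes \<tau> \<Delta>\<^sub>0) X \<and>
         (\<forall>\<epsilon>. max 0 ((lam\<^sub>1 - lam\<^sub>2 * (N + 1) - 1) / (N + 2)) < \<epsilon> \<and>
               \<epsilon> < (lam\<^sub>1 - lam\<^sub>2 * (N + 1)) / (N + 2) \<longrightarrow>
            (\<exists>\<Delta>s>0. \<exists>Ct>0. \<exists>Ct\<^sub>0.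
               Ct = min Ct\<^sub>0 lam\<^sub>0 \<and>
               Ct\<^sub>0 = lam\<^sub>1 - \<epsilon> - (lam\<^sub>2 + \<epsilon>) * (N + 1) \<and> Ct\<^sub>0 < 1 \<and>
               (\<forall>\<Delta>\<in>step_sizes \<tau> \<Delta>\<^sub>0. \<Delta> \<le> \<Delta>s \<longrightarrow>
                  (\<forall>C. 0 < C \<and> C < Ct \<longrightarrow>
                     (AE \<omega> in M. path_exponent \<Delta> (X \<Delta>) \<omega> \<le> ereal (- C / 2)) \<and>
                     ms_exponent M \<Delta> (X \<Delta>) \<le> ereal (- C)))))"
proof -
  let ?q = "nat \<lfloor>inverse (1 - \<eta>)\<rfloor> + 1"
  note hpos = assms(20) and h_lim = assms(23) and \<eta> = assms(25) and \<delta>'_le = assms(26)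
    and lipschitz = assms(29) and consts_pos = assms(30-33)
    and dissipative = assms(34) and gap = assms(35) and L_lim = assms(36)
  have N0: "0 \<le> N" using \<eta> by (simp add: N_def)
  have qN: "real ?q = N + 1" using N0 by (simp add: N_def)
  \<comment> \<open>In these terms \<open>Ct\<^sub>0\<close> is
    \<open>d - \<epsilon> * (N + 2)\<close>: the two bounds on \<open>\<epsilon>\<close> give
    \<open>0 < Ct\<^sub>0\<close> and \<open>Ct\<^sub>0 < 1\<close>.\<close>
  define d where "d = lam\<^sub>1 - lam\<^sub>2 * (N + 1)"
  have d: "0 < d" using gap by (simp add: d_def)
  have incr: "\<delta> t - \<delta> s \<le> \<eta> * (t - s)" if "0 \<le> s" "s \<le> t" for s t
    by (rule increment_le_derivative_bound[OF assms(12) \<delta>'_le that])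

  have decay: "\<exists>\<Delta>s>0. \<forall>\<Delta>\<in>step_sizes \<tau> \<Delta>\<^sub>0. \<Delta> \<le> \<Delta>s \<longrightarrow>
      (\<forall>C. 0 < C \<and> C < min (d - \<epsilon> * (N + 2)) lam\<^sub>0 \<longrightarrow>
         (AE \<omega> in M. path_exponent \<Delta> (X \<Delta>) \<omega> \<le> ereal (- C / 2)) \<and> ms_exponent M \<Delta> (X \<Delta>) \<le> ereal (- C))"
    if \<epsilon>: "0 < \<epsilon>" "(d - 1) / (N + 2) < \<epsilon>" "\<epsilon> < d / (N + 2)" for \<epsilon>
  proof -
    \<comment> \<open>\<open>truncated_energy\<close> loses twice its tolerance, so
      \<open>\<epsilon> / 4\<close> leads to a loss of \<open>\<epsilon> / 2\<close>.\<close>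
    have "0 < \<epsilon> / 4" "0 \<le> K" using \<epsilon> consts_pos by auto
    from truncation_threshold[OF h_lim assms(22,19) L_lim this]
    obtain \<Delta>1 where \<Delta>1: "0 < \<Delta>1"
      "\<And>\<Delta>. 0 < \<Delta> \<Longrightarrow> \<Delta> \<le> \<Delta>1 \<Longrightarrow> \<Delta> \<le> \<Delta>\<^sub>0 \<Longrightarrow> K / (h \<Delta>)\<^sup>2 \<le> \<epsilon> / 4"
      "\<And>\<Delta> t. 0 < \<Delta> \<Longrightarrow> \<Delta> \<le> \<Delta>1 \<Longrightarrow> \<Delta> \<le> \<Delta>\<^sub>0 \<Longrightarrow> 0 \<le> t \<Longrightarrow> 2 * ((1 + t) * (L (h \<Delta>) t)\<^sup>2 * \<Delta>) \<le> \<epsilon> / 4"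
      by blast
    \<comment> \<open>Only \<open>\<epsilon> / 2\<close> is spent on the one-step estimate: the other half absorbs the growth factor
      \<open>1 + \<Delta>\<close> of the weights, so that \<open>\<Delta>s\<close> does not depend on \<open>C\<close>.\<close>
    define \<beta> where "\<beta> = lam\<^sub>2 + \<epsilon> / 2"
    have \<beta>: "0 < \<beta>" using consts_pos \<epsilon> by (simp add: \<beta>_def)
    define \<Delta>s where "\<Delta>s = min \<Delta>1 (\<epsilon> / (2 * \<beta>))"
    show ?thesis
    proof (intro exI[of _ \<Delta>s] conjI ballI impI allI; (elim conjE)?)
      show "0 < \<Delta>s" using \<Delta>1 \<beta> \<epsilon> by (simp add: \<Delta>s_def)
      fix \<Delta> C
      assume "\<Delta> \<in> step_sizes \<tau> \<Delta>\<^sub>0" and le: "\<Delta> \<le> \<Delta>s" and C: "0 < C" "C < min (d - \<epsilon> * (N + 2)) lam\<^sub>0"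
      then obtain m :: nat where \<Delta>: "0 < \<Delta>" "\<Delta> < 1" "\<Delta> \<le> \<Delta>\<^sub>0" and m: "\<tau> = real m * \<Delta>"
        by (auto simp: step_sizes_def)
      have h\<Delta>: "0 < h \<Delta>" using \<Delta> hpos by auto
      have \<Delta>le1: "\<Delta> \<le> \<Delta>1" using le by (simp add: \<Delta>s_def)
      \<comment> \<open>The coefficients vanish at the origin, so the Lipschitz bound against the
        point \<open>(0, 0)\<close> is a linear growth bound on the ball.\<close>
      have growth: "max (norm (f x y t)) (norm (g x y t)) \<le> L (h \<Delta>) t * (norm x + norm y)"
        if "0 \<le> t" "max (norm x) (norm y) \<le> h \<Delta>" for x y t
        using lipschitz[OF h\<Delta> \<open>0 \<le> t\<close>, of x 0 y 0] that h\<Delta> assms(17,18) by auto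
      interpret S: mtem_scheme M F B f g \<delta> h \<xi> \<tau> \<Delta> m "\<lambda>k. L (h \<Delta>) (real k * \<Delta>)"
      proof (intro mtem_scheme.intro mtem_scheme_axioms.intro)
        fix k :: nat and x y
        show "norm (truncated h \<Delta> f x y (real k * \<Delta>)) \<le> L (h \<Delta>) (real k * \<Delta>) * (norm x + norm y)"
          using growth \<Delta> by (intro norm_truncated_le[where h = h and \<Delta> = \<Delta>, OF h\<Delta>]) auto
        show "norm (truncated h \<Delta> g x y (real k * \<Delta>)) \<le> L (h \<Delta>) (real k * \<Delta>) * (norm x + norm y)"
          using growth \<Delta> by (intro norm_truncated_le[where h = h and \<Delta> = \<Delta>, OF h\<Delta>]) auto
        show "- int m \<le> int k - int (nat \<lfloor>\<delta> (real k * \<Delta>) / \<Delta>\<rfloor>)"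
          using incr \<eta> \<Delta>(1) assms(11) m by (intro delay_index_lower_bound) auto
      qed (use assms \<Delta> m in blast)+
      \<comment> \<open>Since \<open>\<beta> * \<Delta>\<close> is at most
        \<open>\<epsilon> / 2\<close>, the delayed coefficient stays below
        \<open>lam\<^sub>2 + \<epsilon>\<close>, and the balance reduces to
        \<open>C < d - \<epsilon> * (N + 2)\<close>.\<close>
      have coeff: "C + \<beta> * (1 + \<Delta>) * real ?q \<le> lam\<^sub>1 - \<epsilon>"
      proof -
        have "\<Delta> \<le> \<epsilon> / (2 * \<beta>)" using le by (simp add: \<Delta>s_def)
        then have "\<beta> * \<Delta> \<le> \<epsilon> / 2" using \<beta> by (simp add: field_simps)
        then have "\<beta> * (1 + \<Delta>) \<le> lam\<^sub>2 + \<epsilon>" by (simp add: \<beta>_def distrib_left)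
        then have "\<beta> * (1 + \<Delta>) * real ?q \<le> (lam\<^sub>2 + \<epsilon>) * (N + 1)"
          unfolding qN using N0 by (intro mult_right_mono) auto
        then show ?thesis using C by (simp add: d_def algebra_simps)
      qed
      have "d - \<epsilon> * (N + 2) < 1" using \<epsilon>(2) N0 by (simp add: field_simps)
      then have C1: "C < 1" "C < lam\<^sub>0" using C by auto
      have "0 \<le> \<beta> * (1 + \<Delta>) * real ?q" using \<beta> \<Delta> by simp
      then have \<alpha>: "0 \<le> lam\<^sub>1 - \<epsilon>" using coeff C by linarith
      have energy: "\<Delta> * (2 * (S.X (int k) \<omega> \<bullet> S.drift k \<omega>) + (norm (S.diffusion k \<omega>))\<^sup>2) + \<Delta>\<^sup>2 * (norm (S.drift k \<omega>))\<^sup>2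
        \<le> \<Delta> / (1 + real k * \<Delta>) * (K * (1 + real k * \<Delta>) powr (- lam\<^sub>0)
            - (lam\<^sub>1 - \<epsilon>) * (norm (S.X (int k) \<omega>))\<^sup>2 + \<beta> * (norm (S.X (S.idx k) \<omega>))\<^sup>2)" for k \<omega>
      proof -
        define t where "t = real k * \<Delta>"
        have t: "0 \<le> t" using \<Delta> by (simp add: t_def)
        define x y where "x = S.X (int k) \<omega>" and "y = S.X (S.idx k) \<omega>"
        have "\<Delta> * (2 * (x \<bullet> S.drift k \<omega>) + (norm (S.diffusion k \<omega>))\<^sup>2) + \<Delta>\<^sup>2 * (norm (S.drift k \<omega>))\<^sup>2
          \<le> \<Delta> / (1 + t) * (K * (1 + t) powr (- lam\<^sub>0) - (lam\<^sub>1 - 2 * (\<epsilon> / 4)) * (norm x)\<^sup>2 + (lam\<^sub>2 + 2 * (\<epsilon> / 4)) * (norm y)\<^sup>2)"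
          unfolding S.drift_def S.diffusion_def x_def[symmetric] y_def[symmetric] t_def[symmetric]
          using consts_pos S.f_growth[of x y k] \<Delta>1(2)[OF \<Delta>(1) \<Delta>le1 \<Delta>(3)] \<Delta>1(3)[OF \<Delta>(1) \<Delta>le1 \<Delta>(3) t]
          unfolding t_def[symmetric]
          by (intro truncated_energy[where h = h and \<Delta> = \<Delta> and f = f and g = g and K = K and p = lam\<^sub>0
              and a = lam\<^sub>1 and b = lam\<^sub>2 and l = "L (h \<Delta>) t", OF h\<Delta> t \<Delta>(1) _ _ dissipative[OF t]]) auto
        \<comment> \<open>The undelayed coefficient is relaxed from
          \<open>lam\<^sub>1 - \<epsilon> / 2\<close> to \<open>lam\<^sub>1 - \<epsilon>\<close>,
          the one that occurs in \<open>Ct\<^sub>0\<close>.\<close>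
        also have "\<dots> \<le> \<Delta> / (1 + t) * (K * (1 + t) powr (- lam\<^sub>0) - (lam\<^sub>1 - \<epsilon>) * (norm x)\<^sup>2 + \<beta> * (norm y)\<^sup>2)"
        proof (rule mult_left_mono)
          have "(lam\<^sub>1 - \<epsilon>) * (norm x)\<^sup>2 \<le> (lam\<^sub>1 - 2 * (\<epsilon> / 4)) * (norm x)\<^sup>2"
            using \<epsilon> by (intro mult_right_mono) auto
          then show "K * (1 + t) powr (- lam\<^sub>0) - (lam\<^sub>1 - 2 * (\<epsilon> / 4)) * (norm x)\<^sup>2 + (lam\<^sub>2 + 2 * (\<epsilon> / 4)) * (norm y)\<^sup>2
            \<le> K * (1 + t) powr (- lam\<^sub>0) - (lam\<^sub>1 - \<epsilon>) * (norm x)\<^sup>2 + \<beta> * (norm y)\<^sup>2"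
            by (simp add: \<beta>_def)
        qed (use \<Delta> t in simp)
        finally show ?thesis by (simp only: x_def y_def t_def)
      qed
      have fibre: "card {k \<in> {..<n}. S.idx k = j} \<le> ?q" for n j
        unfolding S.idx_def by (rule card_delay_fibre_le[OF incr assms(10) \<eta> \<Delta>(1)]) auto
      have SX: "S.X = X \<Delta>" by (simp only: S.X_def X_def)
      note S.polynomial_decay[OF less_imp_le[OF \<Delta>(2)] C(1) C1 \<alpha> less_imp_le[OF \<beta>]
          less_imp_le[OF consts_pos(1)] coeff energy fibre]
      then show "AE \<omega> in M. path_exponent \<Delta> (X \<Delta>) \<omega> \<le> ereal (- C / 2)"
        and "ms_exponent M \<Delta> (X \<Delta>) \<le> ereal (- C)"
        unfolding SX by blast+
    qed
  qed

  have rates: "\<exists>\<Delta>s>0. \<exists>Ct>0. \<exists>Ct\<^sub>0.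
               Ct = min Ct\<^sub>0 lam\<^sub>0 \<and>
               Ct\<^sub>0 = lam\<^sub>1 - \<epsilon> - (lam\<^sub>2 + \<epsilon>) * (N + 1) \<and> Ct\<^sub>0 < 1 \<and>
               (\<forall>\<Delta>\<in>step_sizes \<tau> \<Delta>\<^sub>0. \<Delta> \<le> \<Delta>s \<longrightarrow>
                  (\<forall>C. 0 < C \<and> C < Ct \<longrightarrow>
                     (AE \<omega> in M. path_exponent \<Delta> (X \<Delta>) \<omega> \<le> ereal (- C / 2)) \<and>
                     ms_exponent M \<Delta> (X \<Delta>) \<le> ereal (- C)))"
    if \<epsilon>: "max 0 ((lam\<^sub>1 - lam\<^sub>2 * (N + 1) - 1) / (N + 2)) < \<epsilon> \<and>
               \<epsilon> < (lam\<^sub>1 - lam\<^sub>2 * (N + 1)) / (N + 2)" for \<epsilon>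
  proof -
    have \<epsilon>': "0 < \<epsilon>" "(d - 1) / (N + 2) < \<epsilon>" "\<epsilon> < d / (N + 2)" using \<epsilon> by (auto simp: d_def)
    have Ct0: "lam\<^sub>1 - \<epsilon> - (lam\<^sub>2 + \<epsilon>) * (N + 1) = d - \<epsilon> * (N + 2)" by (simp add: d_def algebra_simps)
    have "d - \<epsilon> * (N + 2) < 1" "0 < d - \<epsilon> * (N + 2)"
      using \<epsilon>'(2,3) N0 by (simp_all add: field_simps)
    moreover from decay[OF \<epsilon>'] obtain \<Delta>s where "0 < \<Delta>s" and "\<forall>\<Delta>\<in>step_sizes \<tau> \<Delta>\<^sub>0. \<Delta> \<le> \<Delta>s \<longrightarrow>
      (\<forall>C. 0 < C \<and> C < min (d - \<epsilon> * (N + 2)) lam\<^sub>0 \<longrightarrow>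
         (AE \<omega> in M. path_exponent \<Delta> (X \<Delta>) \<omega> \<le> ereal (- C / 2)) \<and> ms_exponent M \<Delta> (X \<Delta>) \<le> ereal (- C))"
      by blast
    ultimately show ?thesis
      using consts_pos(2)
      by - (rule exI[of _ \<Delta>s], rule conjI, simp, rule exI[of _ "min (d - \<epsilon> * (N + 2)) lam\<^sub>0"],
          auto simp: Ct0)
  qed

  \<comment> \<open>The admissible interval is nonempty because \<open>d\<close> is positive and
    exceeds \<open>d - 1\<close>; any one member yields both stability notions.\<close>
  obtain \<epsilon> where "max 0 ((lam\<^sub>1 - lam\<^sub>2 * (N + 1) - 1) / (N + 2)) < \<epsilon> \<and>
               \<epsilon> < (lam\<^sub>1 - lam\<^sub>2 * (N + 1)) / (N + 2)"
  proof -
    have "max 0 ((lam\<^sub>1 - lam\<^sub>2 * (N + 1) - 1) / (N + 2)) < (lam\<^sub>1 - lam\<^sub>2 * (N + 1)) / (N + 2)"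
      using gap N0 by (simp add: divide_strict_right_mono)
    then show thesis using dense that by blast
  qed
  from rates[OF this] obtain \<Delta>s Ct where \<Delta>s: "0 < \<Delta>s" and Ct: "0 < Ct"
    and rate: "\<And>\<Delta> C. \<Delta> \<in> step_sizes \<tau> \<Delta>\<^sub>0 \<Longrightarrow> \<Delta> \<le> \<Delta>s \<Longrightarrow> 0 < C \<Longrightarrow> C < Ct \<Longrightarrow>
        (AE \<omega> in M. path_exponent \<Delta> (X \<Delta>) \<omega> \<le> ereal (- C / 2)) \<and> ms_exponent M \<Delta> (X \<Delta>) \<le> ereal (- C)"
    by blast
  \<comment> \<open>Stability demands strict inequalities. With \<open>C = Ct / 2\<close> the
    exponents are at most \<open>- Ct / 4\<close> and \<open>- Ct / 2\<close>, both strictly below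
    \<open>- Ct / 8\<close>.\<close>
  have half: "(AE \<omega> in M. path_exponent \<Delta> (X \<Delta>) \<omega> \<le> ereal (- (Ct / 2) / 2)) \<and> ms_exponent M \<Delta> (X \<Delta>) \<le> ereal (- (Ct / 2))"
    if "\<Delta> \<in> step_sizes \<tau> \<Delta>\<^sub>0" "\<Delta> \<le> \<Delta>s" for \<Delta>
    using rate[OF that, of "Ct / 2"] Ct by simp
  have less: "ereal (- (Ct / 2) / 2) < ereal (- (Ct / 8))" "ereal (- (Ct / 2)) < ereal (- (Ct / 8))"
    using Ct by simp_all
  have "as_polynomially_stable M (step_sizes \<tau> \<Delta>\<^sub>0) X"
    unfolding as_polynomially_stable_def
  proof (rule exI[of _ \<Delta>s], rule conjI[OF \<Delta>s], rule exI[of _ "Ct / 8"], intro conjI ballI impI)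
    fix \<Delta> assume "\<Delta> \<in> step_sizes \<tau> \<Delta>\<^sub>0" "\<Delta> \<le> \<Delta>s"
    then have "AE \<omega> in M. path_exponent \<Delta> (X \<Delta>) \<omega> \<le> ereal (- (Ct / 2) / 2)" using half by blast
    then show "AE \<omega> in M. path_exponent \<Delta> (X \<Delta>) \<omega> < ereal (- (Ct / 8))"
      by (rule AE_mp) (intro AE_I2 impI, erule le_less_trans[OF _ less(1)])
  qed (use Ct in simp)
  moreover have "ms_polynomially_stable M (step_sizes \<tau> \<Delta>\<^sub>0) X"
    unfolding ms_polynomially_stable_def
  proof (rule exI[of _ \<Delta>s], rule conjI[OF \<Delta>s], rule exI[of _ "Ct / 8"], intro conjI ballI impI)
    fix \<Delta> assume "\<Delta> \<in> step_sizes \<tau> \<Delta>\<^sub>0" "\<Delta> \<le> \<Delta>s"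
    then show "ms_exponent M \<Delta> (X \<Delta>) < ereal (- (Ct / 8))" using half le_less_trans[OF _ less(2)] by blast
  qed (use Ct in simp)
  ultimately show ?thesis using rates by blast
qed

end
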